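(* The map $\Phi_m:\mathbb R_{\rm C}\to(\mathbb Z/m\mathbb Z)((q))\sqcup\{\infty\}$ is injective for every integer $m\ge2$. If $p$ is prime, then $\Phi_p$ is a closed embedding into $\mathbb P^1(\mathbb F_p((q)))$; for $p=2$ it is a homeomorphism.
   Context: The Cantor line is $\mathbb R_{\rm C}:=(\mathbb R\setminus\mathbb Q)\sqcup\mathbb Q_+\sqcup\mathbb Q_-\sqcup\{-\infty,+\infty\}$, where each rational $r$ is doubled into $r_-<r_+$; it is totally ordered in the evident way (with minimum $-\infty$ and maximum $+\infty$) and given the order topology. $[n]_q=\frac{1-q^n}{1-q}$. For real $x\ge1$ with its unique expansion $x=[[c_1,c_2,\ldots]]=c_1-\frac1{c_2-\frac{1}{c_3-\cdots}}$, integers $c_j\ge2$, $[x]_q\in\mathbb Z[[q]]$ is the $q$-adic limit of $[c_1]_q-\frac{q^{c_1-1}}{[c_2]_q-\cdots\frac{q^{c_{N-1}-1}}{[c_N]_q}}$; it is extended to all real $x$ with values in $\mathbb Z((q))$ by $[x+1]_q=q[x]_q+1$. For rational $r=[[c_1,\ldots,c_N]]>1$ (finite expansion, $c_i\ge2$), $[r]_q^-\in\mathbb Z[[q]]$ is obtained from the finite continued fraction $[c_1]_q-\frac{q^{c_1-1}}{[c_2]_q-\cdots\frac{q^{c_{N-1}-1}}{[c_N]_q}}$ by replacing the last entry $[c_N]_q$ with $[c_N]_q-q^{c_N-1}(1-q)$; it is extended to all $r\in\mathbb Q$ by $[r+1]_q^-=q[r]_q^-+1$. For $m\ge2$ let $\mathrm{red}_m$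 be coefficientwise reduction modulo $m$. Define $\Phi_m(x)=\mathrm{red}_m([x]_q)$ for irrational $x$, $\Phi_m(r_+)=\mathrm{red}_m([r]_q)$ and $\Phi_m(r_-)=\mathrm{red}_m([r]_q^-)$ for $r\in\mathbb Q$, $\Phi_m(+\infty)=(1-q)^{-1}$, $\Phi_m(-\infty)=\infty$. The ring $(\mathbb Z/m\mathbb Z)((q))$ has the $q$-adic topology and adding $\infty$ is one-point compactification; for $m=p$ prime the target is $\mathbb P^1(\mathbb F_p((q)))$. *)

theory Defs
  imports
    "HOL-Analysis.Analysis"
    "HOL-Computational_Algebra.Computational_Algebra"
    "Berlekamp_Zassenhaus.Finite_Field"
begin

section \<open>The Cantor line\<close>

typedef irrational = "{x :: real. x \<notin> \<rat>}"
  morphisms real_of_irrational Abs_irrational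
  using uncountable_UNIV_real countable_rat countable_subset[of UNIV "\<rat> :: real set"] by blast

text \<open>\<^term>\<open>RatMinus r\<close> and \<^term>\<open>RatPlus r\<close> are the two copies $r_- < r_+$ of the rational $r$.\<close>

datatype cantor_line =
    NegInf
  | PosInf
  | Irr irrational
  | RatMinus rat
  | RatPlus rat

fun cantor_val :: "cantor_line \<Rightarrow> ereal" where
  "cantor_val NegInf = -\<infinity>"
| "cantor_val PosInf = \<infinity>"
| "cantor_val (Irr x) = ereal (real_of_irrational x)"
| "cantor_val (RatMinus r) = ereal (of_rat r)"
| "cantor_val (RatPlus r) = ereal (of_rat r)"

fun cantor_side :: "cantor_line \<Rightarrow> int" where
  "cantor_side (RatMinus r) = -1"
| "cantor_side (RatPlus r) = 1"
| "cantor_side _ = 0"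

lemma cantor_val_side_inject:
  assumes "cantor_val x = cantor_val y" "cantor_side x = cantor_side y"
  shows "x = y"
  using assms real_of_irrational
  by (cases x; cases y) (auto simp: real_of_irrational_inject)

instantiation cantor_line :: linorder
begin

definition less_eq_cantor_line :: "cantor_line \<Rightarrow> cantor_line \<Rightarrow> bool" where
  "x \<le> y \<longleftrightarrow> cantor_val x < cantor_val y
     \<or> cantor_val x = cantor_val y \<and> cantor_side x \<le> cantor_side y"

definition less_cantor_line :: "cantor_line \<Rightarrow> cantor_line \<Rightarrow> bool" where
  "x < y \<longleftrightarrow> cantor_val x < cantor_val y
     \<or> cantor_val x = cantor_val y \<and> cantor_side x < cantor_side y"

instance
proof
  fix x y :: cantor_line
  assume "x \<le> y" "y \<le> x"
  then show "x = y"
    by (intro cantor_val_side_inject) (auto simp: less_eq_cantor_line_def)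
qed (auto simp: less_eq_cantor_line_def less_cantor_line_def)

end

instantiation cantor_line :: linorder_topology
begin

definition open_cantor_line :: "cantor_line set \<Rightarrow> bool" where
  "open_cantor_line = generate_topology (range (\<lambda>a. {..<a}) \<union> range (\<lambda>a. {a<..}))"

instance
  by standard (rule open_cantor_line_def)

end

section \<open>Hirzebruch--Jung continued fractions and $q$-numbers\<close>

text \<open>
  \<open>hj_frac [c\<^sub>1, \<dots>, c\<^sub>N]\<close> is $c_1 - 1/(c_2 - 1/(\cdots - 1/c_N))$.
  The value at the empty list is a dummy.
\<close>

fun hj_frac :: "nat list \<Rightarrow> real" where
  "hj_frac [] = 0"
| "hj_frac [c] = real c"
| "hj_frac (c # d # cs) = real c - 1 / hj_frac (d # cs)"

definition hj_expansion :: "real \<Rightarrow> (nat \<Rightarrow> nat) \<Rightarrow> bool" where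
  "hj_expansion x c \<longleftrightarrow>
     (\<forall>j. 2 \<le> c j) \<and> (\<lambda>N. hj_frac (map c [0..<Suc N])) \<longlonglongrightarrow> x"

definition hj_expansion_rat :: "rat \<Rightarrow> nat list \<Rightarrow> bool" where
  "hj_expansion_rat r cs \<longleftrightarrow>
     cs \<noteq> [] \<and> (\<forall>c\<in>set cs. 2 \<le> c) \<and> hj_frac cs = of_rat r"

text \<open>
  Over a ring that is not a field, \<open>fps\<close> has no \<open>inverse\<close> operation. For a series with constant
  coefficient $1$ the following is its multiplicative inverse; it is used for such series only
  (all entries $c_j$ being at least $2$, the denominators below have constant coefficient $1$).
\<close>

definition fps_unit_inv :: "'a :: comm_ring_1 fps \<Rightarrow> 'a fps" where
  "fps_unit_inv f = fps_right_inverse f 1"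

lemma fps_unit_inv:
  assumes "fps_nth f 0 = 1"
  shows "f * fps_unit_inv f = 1"
  unfolding fps_unit_inv_def using assms by (intro fps_right_inverse) simp

definition q_int :: "nat \<Rightarrow> int fps" where
  "q_int n = (1 - fps_X ^ n) * fps_unit_inv (1 - fps_X)"

text \<open>
  $[c_1]_q - \frac{q^{c_1-1}}{[c_2]_q - \cdots}$, where the last entry is \<open>last_entry c\<^sub>N\<close> in place
  of $[c_N]_q$. The value at the empty list is a dummy.
\<close>

fun q_frac :: "(nat \<Rightarrow> int fps) \<Rightarrow> nat list \<Rightarrow> int fps" where
  "q_frac last_entry [] = 0"
| "q_frac last_entry [c] = last_entry c"
| "q_frac last_entry (c # d # cs) =
     q_int c - fps_X ^ (c - 1) * fps_unit_inv (q_frac last_entry (d # cs))"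

definition q_real_ge1 :: "real \<Rightarrow> int fps" where
  "q_real_ge1 x = (let c = (THE c. hj_expansion x c)
     in lim (\<lambda>N. q_frac q_int (map c [0..<Suc N])))"

definition q_left_gt1 :: "rat \<Rightarrow> int fps" where
  "q_left_gt1 r = q_frac (\<lambda>c. q_int c - fps_X ^ (c - 1) * (1 - fps_X))
     (THE cs. hj_expansion_rat r cs)"

text \<open>
  The rule $[x+1]_q = q [x]_q + 1$, read as $[x]_q = q^{-1}([x+1]_q - 1)$, determines the values
  below the initial range.
\<close>

function q_real :: "real \<Rightarrow> int fls" where
  "q_real x = (if x \<ge> 1 then fps_to_fls (q_real_ge1 x) else fls_X_inv * (q_real (x + 1) - 1))"
  by auto
termination
  by (relation "Wellfounded.measure (\<lambda>x. nat \<lceil>1 - x\<rceil>)") (auto, linarith)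

function q_left :: "rat \<Rightarrow> int fls" where
  "q_left r = (if r > 1 then fps_to_fls (q_left_gt1 r) else fls_X_inv * (q_left (r + 1) - 1))"
  by auto
termination
  by (relation "Wellfounded.measure (\<lambda>r. nat (\<lfloor>1 - r\<rfloor> + 1))") (auto, linarith)

declare q_real.simps [simp del] q_left.simps [simp del]

section \<open>The map $\Phi_m$\<close>

text \<open>
  \<^typ>\<open>'m mod_ring\<close> is the ring $\mathbb Z/m\mathbb Z$ with \<open>m = CARD('m)\<close>; the class
  \<^class>\<open>nontriv\<close> says $m \ge 2$, and \<^class>\<open>prime_card\<close> says that $m$ is prime. The metric
  topology on \<^typ>\<open>'m mod_ring fls\<close> is the $q$-adic one. The point $\infty$ is \<^term>\<open>None\<close>.
\<close>

definition fls_red :: "int fls \<Rightarrow> 'm :: nontriv mod_ring fls" where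
  "fls_red f = Abs_fls (\<lambda>n. of_int (fls_nth f n))"

lemma fls_nth_fls_red [simp]: "fls_nth (fls_red f) n = of_int (fls_nth f n)"
  unfolding fls_red_def
  by (subst nth_Abs_fls) (auto intro: eventually_mono[OF MOST_fls_neg_nth_eq_0[of f]])

fun Phi :: "cantor_line \<Rightarrow> 'm :: nontriv mod_ring fls option" where
  "Phi (Irr x) = Some (fls_red (q_real (real_of_irrational x)))"
| "Phi (RatPlus r) = Some (fls_red (q_real (of_rat r)))"
| "Phi (RatMinus r) = Some (fls_red (q_left r))"
| "Phi PosInf = Some (fps_to_fls (fps_unit_inv (1 - fps_X)))"
| "Phi NegInf = None"

section \<open>The projective line\<close>

text \<open>
  The point $[a:b]$ of $\mathbb P^1(K)$ is recorded by its affine coordinate $a/b \in K$, or by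
  $\infty$ (\<^term>\<open>None\<close>) if $b = 0$; the topology is the quotient topology of $K^2 \setminus \{0\}$.
\<close>

definition proj_coord :: "'k :: field \<times> 'k \<Rightarrow> 'k option" where
  "proj_coord v = (if snd v = 0 then None else Some (fst v / snd v))"

definition projective_line :: "'k :: {field, topological_space} option topology" where
  "projective_line = topology (\<lambda>U. openin (top_of_set (- {0})) {v \<in> - {0}. proj_coord v \<in> U})"

lemma openin_projective_line:
  "openin projective_line U \<longleftrightarrow> openin (top_of_set (- {0})) {v \<in> - {0}. proj_coord v \<in> U}"
proof -
  have "istopology (\<lambda>U :: 'a option set. openin (top_of_set (- {0})) {v \<in> - {0}. proj_coord v \<in> U})"
    unfolding istopology_def
  proof (intro conjI allI impI)
    fix S T :: "'a option set"
    assume "openin (top_of_set (- {0})) {v \<in> - {0}. proj_coord v \<in> S}"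
      and "openin (top_of_set (- {0})) {v \<in> - {0}. proj_coord v \<in> T}"
    then have "openin (top_of_set (- {0}))
        ({v \<in> - {0}. proj_coord v \<in> S} \<inter> {v \<in> - {0}. proj_coord v \<in> T})"
      by (rule openin_Int)
    also have "{v \<in> - {0}. proj_coord v \<in> S} \<inter> {v \<in> - {0}. proj_coord v \<in> T}
        = {v \<in> - {0}. proj_coord v \<in> S \<inter> T}"
      by auto
    finally show "openin (top_of_set (- {0})) {v \<in> - {0}. proj_coord v \<in> S \<inter> T}" .
  next
    fix \<K> :: "'a option set set"
    assume "\<forall>U\<in>\<K>. openin (top_of_set (- {0})) {v \<in> - {0}. proj_coord v \<in> U}"
    then have "openin (top_of_set (- {0})) (\<Union>U\<in>\<K>. {v \<in> - {0}. proj_coord v \<in> U})"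
      by blast
    also have "(\<Union>U\<in>\<K>. {v \<in> - {0}. proj_coord v \<in> U}) = {v \<in> - {0}. proj_coord v \<in> \<Union>\<K>}"
      by auto
    finally show "openin (top_of_set (- {0})) {v \<in> - {0}. proj_coord v \<in> \<Union>\<K>}" .
  qed
  then show ?thesis
    by (simp add: projective_line_def)
qed

lemma quotient_map_proj_coord:
  "quotient_map (top_of_set (- {0})) projective_line proj_coord"
proof -
  have im: "proj_coord ` (- {0}) = (UNIV :: 'a option set)"
  proof -
    have "u \<in> proj_coord ` (- {0})" for u :: "'a option"
    proof (cases u)
      case None
      then have "u = proj_coord (1, 0)" by (simp add: proj_coord_def)
      then show ?thesis by (auto simp: zero_prod_def)
    next
      case (Some x)
      then have "u = proj_coord (x, 1)" by (simp add: proj_coord_def)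
      then show ?thesis by (auto simp: zero_prod_def)
    qed
    then show ?thesis by blast
  qed
  have "openin projective_line (UNIV :: 'a option set)"
    unfolding openin_projective_line by (metis (no_types, lifting) Collect_cong Collect_mem_eq UNIV_I openin_subtopology_self)
  then have "topspace projective_line = (UNIV :: 'a option set)"
    using openin_subset by blast
  then show ?thesis
    by (simp add: quotient_map_def im openin_projective_line)
qed

lemma dist_fls_eq_powi:
  fixes x y :: "'a::group_add fls"
  assumes "x \<noteq> y"
  shows "dist x y = 2 powi (- fls_subdegree (x - y))"
  using assms by (auto simp: dist_fls_def power_int_def power_one_over inverse_eq_divide)

lemma dist_fls_0_mult:
  fixes x y :: "'a::field fls"
  shows "dist (x * y) 0 = dist x 0 * dist y 0"
  by (cases "x = 0 \<or> y = 0") (auto simp: dist_fls_eq_powi power_int_diff power_int_minus field_simps)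

lemma dist_fls_diff:
  fixes x y :: "'a::group_add fls"
  shows "dist x y = dist (x - y) 0"
  by (cases "x = y") (auto simp: dist_fls_eq_powi)

lemma dist_fls_ultra:
  fixes x y :: "'a::group_add fls"
  shows "dist x 0 \<le> max (dist y 0) (dist x y)"
proof (cases "x = 0 \<or> y = 0 \<or> x = y")
  case False
  have "min (fls_subdegree (x - y)) (fls_subdegree y) \<le> fls_subdegree ((x - y) + y)"
    using False by (intro fls_plus_subdegree) auto
  then consider "fls_subdegree (x - y) \<le> fls_subdegree x" | "fls_subdegree y \<le> fls_subdegree x"
    by (auto simp: min_def split: if_splits)
  then show ?thesis
    using False by cases (auto simp: dist_fls_eq_powi le_max_iff_disj intro: power_int_increasing)
qed (auto simp: dist_commute)

lemma dist_fls_eq_near: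
  fixes x y :: "'a::group_add fls"
  assumes "dist x y < dist y 0"
  shows "dist x 0 = dist y 0"
  using assms dist_fls_ultra[of x y] dist_fls_ultra[of y x] by (auto simp: dist_commute max_def split: if_splits)

lemma dist_fls_divide:
  fixes x y :: "'a::field fls"
  shows "dist (x / y) 0 = dist x 0 / dist y 0"
proof (cases "y = 0")
  case False
  then have "dist (x / y) 0 * dist y 0 = dist x 0"
    by (simp flip: dist_fls_0_mult)
  with False show ?thesis by (simp add: field_simps)
qed auto

lemma dist_fls_divide_less:
  fixes a b a' b' :: "'a::field fls"
  assumes "b \<noteq> 0" "dist b' b < dist b 0"
    and "dist a' a < e * dist b 0" "dist b' b * dist a 0 < e * dist b 0 * dist b 0"
  shows "b' \<noteq> 0" "dist (a' / b') (a / b) < e"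
proof -
  have b': "dist b' 0 = dist b 0" using assms(2) by (rule dist_fls_eq_near)
  then show nz: "b' \<noteq> 0" using assms(1) by (metis dist_eq_0_iff)
  have pos: "dist b 0 > 0" using assms(1) by simp
  have *: "a' / b' - a / b = ((a' - a) * b - a * (b' - b)) / (b * b')"
    using assms(1) nz by (simp add: field_simps)
  have ultra: "dist (p - q) 0 \<le> max (dist p 0) (dist q 0)" for p q :: "'a fls"
    using dist_fls_ultra[of "p - q" p] dist_fls_diff[of "p - q" p] dist_fls_diff[of 0 q]
    by (simp add: dist_commute)
  have "dist ((a' - a) * b - a * (b' - b)) 0 \<le> max (dist ((a' - a) * b) 0) (dist (a * (b' - b)) 0)"
    by (rule ultra)
  also have "\<dots> < e * dist b 0 * dist b 0"
    using assms(3,4) pos by (simp add: dist_fls_0_mult dist_fls_diff[symmetric] mult.commute)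
  finally show "dist (a' / b') (a / b) < e"
    unfolding dist_fls_diff[of "a' / b'"] *
    using pos by (simp add: dist_fls_divide dist_fls_0_mult b' field_simps)
qed

lemma continuous_on_divide_fls:
  "continuous_on {v. snd v \<noteq> 0} (\<lambda>v. fst v / snd v :: 'a::field fls)"
  unfolding continuous_on_iff
proof (intro ballI allI impI, clarify, simp only: fst_conv snd_conv mem_Collect_eq)
  fix a b :: "'a fls" and e :: real
  assume b: "b \<noteq> 0" and e: "e > 0"
  define d where "d = min (dist b 0) (min (e * dist b 0) (e * dist b 0 * dist b 0 / (dist a 0 + 1)))"
  have pos: "dist b 0 > 0" using b by simp
  have a1: "dist a 0 + 1 > 0" by (simp add: add_nonneg_pos)
  have d: "d > 0" using pos e a1 unfolding d_def by simp
  have "dist (fst v / snd v) (a / b) < e" if v: "dist v (a, b) < d" for v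
  proof (rule dist_fls_divide_less(2)[OF b])
    have 1: "dist (fst v) a < d" "dist (snd v) b < d"
      using v dist_fst_le[of v "(a,b)"] dist_snd_le[of v "(a,b)"] by auto
    show "dist (snd v) b < dist b 0" "dist (fst v) a < e * dist b 0"
      using 1 by (auto simp: d_def)
    have "dist (snd v) b * (dist a 0 + 1) < e * dist b 0 * dist b 0"
      using 1 a1 by (simp add: d_def pos_less_divide_eq)
    moreover have "dist (snd v) b * dist a 0 \<le> dist (snd v) b * (dist a 0 + 1)"
      by (intro mult_left_mono) auto
    ultimately show "dist (snd v) b * dist a 0 < e * dist b 0 * dist b 0"
      by linarith
  qed
  then show "\<exists>d>0. \<forall>x'\<in>{v. snd v \<noteq> 0}. dist x' (a, b) < d \<longrightarrow> dist (fst x' / snd x') (a / b) < e"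
    using d by blast
qed

lemma compact_UNIV_fps: "compact (UNIV :: 'a::{comm_ring_1,finite} fps set)"
  unfolding compact_eq_totally_bounded
proof (intro conjI allI impI)
  show "complete (UNIV :: 'a fps set)" by (rule complete_UNIV)
  fix e :: real assume "e > 0"
  then obtain n where n: "inverse (2 ^ n) < e"
    using reals_power_lt_ex[of e 2] by (auto simp: power_inverse field_simps)
  define k where "k = (\<lambda>xs. Abs_fps (\<lambda>i. if i \<le> n then xs ! i else 0)) ` {xs :: 'a list. set xs \<subseteq> UNIV \<and> length xs = Suc n}"
  have "finite k" unfolding k_def by (intro finite_imageI finite_lists_length_eq) auto
  moreover have "f \<in> (\<Union>x\<in>k. ball x e)" for f :: "'a fps"
  proof -
    let ?g = "Abs_fps (\<lambda>i. if i \<le> n then map (fps_nth f) [0..<Suc n] ! i else 0)"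
    have "?g \<in> k" unfolding k_def by (intro imageI) simp
    moreover have "dist ?g f < inverse (2 ^ n)"
      by (rule nth_equal_imp_dist_less) (auto simp del: upt_Suc)
    ultimately show ?thesis using n by (metis UN_I mem_ball order.strict_trans)
  qed
  ultimately show "\<exists>k. finite k \<and> (UNIV :: 'a fps set) \<subseteq> (\<Union>x\<in>k. ball x e)" by blast
qed

lemma compact_fls_ge_subdegree:
  "compact {f :: 'a::{comm_ring_1,finite} fls. \<forall>i < - int n. fls_nth f i = 0}"
proof -
  let ?h = "\<lambda>f :: 'a fps. fls_shift (int n) (fps_to_fls f)"
  have "dist (?h f) (?h g) = 2 ^ n * dist f g" for f g
  proof (cases "f = g")
    case False
    then have ne: "?h f \<noteq> ?h g" by (simp add: fls_shift_eq_iff)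
    have "?h f - ?h g = fls_shift (int n) (fps_to_fls (f - g))"
      by simp
    moreover have "fls_subdegree (fls_shift (int n) (fps_to_fls (f - g))) = int (subdegree (f - g)) - int n"
      using False by (subst fls_shift_subdegree)
        (auto simp: fls_subdegree_fls_to_fps simp del: fps_to_fls_minus)
    ultimately have "dist (?h f) (?h g) = 2 powi (int n - int (subdegree (f - g)))"
      using dist_fls_eq_powi[OF ne] by simp
    also have "\<dots> = 2 ^ n * dist f g"
      using False by (simp add: dist_fps_def power_int_diff field_simps)
    finally show ?thesis .
  qed auto
  note dist_h = this
  have "continuous_on UNIV ?h"
    unfolding continuous_on_iff
  proof (intro ballI allI impI)
    fix f :: "'a fps" and e :: real
    assume "e > 0"
    then show "\<exists>d>0. \<forall>g\<in>UNIV. dist g f < d \<longrightarrow> dist (?h g) (?h f) < e"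
      by (intro exI[of _ "e / 2 ^ n"]) (simp add: dist_h field_simps)
  qed
  then have "compact (range ?h)"
    by (rule compact_continuous_image) (rule compact_UNIV_fps)
  also have "range ?h = {f. \<forall>i < - int n. fls_nth f i = 0}"
  proof (intro equalityI subsetI)
    fix f :: "'a fls" assume "f \<in> {f. \<forall>i < - int n. fls_nth f i = 0}"
    then have "f = ?h (fls_regpart (fls_shift (- int n) f))"
      by (intro fls_eqI) auto
    then show "f \<in> range ?h" by blast
  qed auto
  finally show ?thesis .
qed

lemma compact_cball_fls: "compact (cball (0 :: 'a::{comm_ring_1,finite} fls) r)"
proof -
  obtain n where n: "r < 2 ^ n" using real_arch_pow[of 2 r] by auto
  have "fls_nth f i = 0" if "f \<in> cball 0 r" "i < - int n" for f :: "'a fls" and i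
  proof (rule ccontr)
    assume nz: "fls_nth f i \<noteq> 0"
    then have f: "fls_subdegree f \<le> i" "f \<noteq> 0" by (auto intro: fls_subdegree_leI)
    then have "2 powi int n \<le> (2 powi (- fls_subdegree f) :: real)"
      using that(2) by (intro power_int_increasing) linarith+
    also have "\<dots> = dist f 0" using f(2) by (simp add: dist_fls_eq_powi)
    also have "\<dots> \<le> r" using that(1) by (simp add: dist_commute)
    finally show False using n by simp
  qed
  then have "cball 0 r \<subseteq> {f :: 'a fls. \<forall>i < - int n. fls_nth f i = 0}" by blast
  then have "cball 0 r = cball 0 r \<inter> {f :: 'a fls. \<forall>i < - int n. fls_nth f i = 0}" by blast
  also have "compact \<dots>"
    by (intro closed_Int_compact closed_cball compact_fls_ge_subdegree)
  finally show ?thesis .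
qed

text \<open>
  So for $K = \mathbb F_p((q))$ the topological space $\mathbb P^1(K)$ is the one-point
  compactification of $K$.
\<close>

lemma projective_line_eq_Alexandroff_compactification:
  "(projective_line :: 'p::prime_card mod_ring fls option topology)
     = Alexandroff_compactification euclidean"
proof (rule topology_eq[THEN iffD2], intro allI iffI)
  fix U :: "'p mod_ring fls option set"
  let ?P = "{v \<in> - {0}. proj_coord v \<in> U}"
  have nz: "open (- {0 :: 'p mod_ring fls \<times> 'p mod_ring fls})" by (simp add: open_Compl)
  have iff: "openin projective_line U \<longleftrightarrow> open ?P"
    unfolding openin_projective_line using nz openin_open_eq by auto
  define V where "V = {x. Some x \<in> U}"
  have snd: "open {v :: 'p mod_ring fls \<times> 'p mod_ring fls. snd v \<noteq> 0}"
    by (intro open_Collect_neq continuous_intros)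
  {
    assume "openin projective_line U"
    then have P: "open ?P" by (simp add: iff)
    have "open ((\<lambda>x. (x, 1)) -` ?P)"
      using P by (rule open_vimage) (intro continuous_intros)
    also have "(\<lambda>x. (x, 1)) -` ?P = V"
      by (auto simp: V_def proj_coord_def zero_prod_def)
    finally have V: "open V" .
    show "openin (Alexandroff_compactification euclidean) U"
    proof (cases "None \<in> U")
      case False
      then have "U = Some ` V"
        unfolding V_def by (auto simp: image_iff) (metis option.exhaust)
      then show ?thesis using V by simp
    next
      case True
      then have U: "U = insert None (Some ` (topspace euclidean - (- V)))"
        unfolding V_def by (auto simp: image_iff) (metis option.exhaust)
      have "(1, 0) \<in> ?P" using True by (simp add: proj_coord_def zero_prod_def)
      from bspec[OF open_dist[THEN iffD1, OF P] this]
      obtain e where e: "e > 0" "\<And>v. dist v (1, 0) < e \<Longrightarrow> v \<in> ?P"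
        by (elim exE conjE) (rule that, assumption, erule allE, erule mp)
      have "- V \<subseteq> cball 0 (1 / e)"
      proof
        fix x assume x: "x \<in> - V"
        show "x \<in> cball 0 (1 / e)"
        proof (rule ccontr)
          assume "x \<notin> cball 0 (1 / e)"
          then have d: "1 / e < dist x 0" by (simp add: dist_commute)
          with e(1) have x0: "x \<noteq> 0" by auto
          have "dist (1 / x) 0 < e"
            using d e(1) x0 by (simp only: dist_fls_divide) (simp add: dist_fls_eq_powi field_simps)
          then have "(1, 1 / x) \<in> ?P" by (intro e(2)) (simp add: dist_Pair_Pair)
          then show False using x x0 by (simp add: proj_coord_def V_def)
        qed
      qed
      then have "- V = - V \<inter> cball 0 (1 / e)" by blast
      also have "compact \<dots>"
        using V by (intro closed_Int_compact compact_cball_fls) (simp add: closed_Compl)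
      finally have "compact (- V)" .
      then show ?thesis
        using V U unfolding openin_Alexandroff_compactification
        by (intro disjI2 exI[of _ "- V"]) auto
    qed
  next
    assume "openin (Alexandroff_compactification euclidean) U"
    then consider W where "open W" "U = Some ` W"
      | C where "compact C" "closed C" "U = insert None (Some ` (- C))"
      unfolding openin_Alexandroff_compactification by (auto simp: Compl_eq_Diff_UNIV)
    then have "open V \<and> (None \<in> U \<longrightarrow> compact (- V))"
    proof cases
      case 1
      then have "V = W" "None \<notin> U" by (auto simp: V_def)
      with 1 show ?thesis by simp
    next
      case 2
      then have "V = - C" by (auto simp: V_def)
      with 2 show ?thesis by (simp add: open_Compl)
    qed
    then have V: "open V" and bd: "None \<in> U \<Longrightarrow> compact (- V)" by blast+
    have fin: "open ({v. snd v \<noteq> 0} \<inter> (\<lambda>v. fst v / snd v) -` V)"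
      by (rule continuous_open_preimage[OF continuous_on_divide_fls snd V])
    have fin_eq: "{v. snd v \<noteq> 0} \<inter> (\<lambda>v. fst v / snd v) -` V \<subseteq> ?P"
      by (auto simp: V_def proj_coord_def)
    have "open ?P"
    proof (subst open_subopen, intro ballI)
      fix v assume v: "v \<in> ?P"
      show "\<exists>T. open T \<and> v \<in> T \<and> T \<subseteq> ?P"
      proof (cases "snd v = 0")
        case False
        then have "v \<in> {v. snd v \<noteq> 0} \<inter> (\<lambda>v. fst v / snd v) -` V"
          using v by (auto simp: proj_coord_def V_def)
        then show ?thesis using fin fin_eq by blast
      next
        case True
        with v have U: "None \<in> U" and a: "fst v \<noteq> 0"
          by (auto simp: proj_coord_def zero_prod_def prod_eq_iff)
        from bd[OF U] obtain M where M: "\<And>x. x \<in> - V \<Longrightarrow> dist x 0 \<le> M"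
          using bounded_any_center[of "- V" 0] compact_imp_bounded by (auto simp: dist_commute)
        define N where "N = max M 1"
        define T :: "('p mod_ring fls \<times> 'p mod_ring fls) set"
          where "T = {w. dist (fst w) (fst v) < dist (fst v) 0} \<inter> {w. dist (snd w) 0 * N < dist (fst v) 0}"
        have "open T" unfolding T_def
          by (intro open_Int open_Collect_less continuous_intros)
        moreover have "v \<in> T" using True a by (simp add: T_def)
        moreover have "w \<in> ?P" if "w \<in> T" for w
        proof -
          from that have 1: "dist (fst w) 0 = dist (fst v) 0" and 2: "dist (snd w) 0 * N < dist (fst v) 0"
            using dist_fls_eq_near[of "fst w" "fst v"] by (auto simp: T_def)
          from 1 a have w0: "fst w \<noteq> 0" by (metis dist_eq_0_iff)
          show ?thesis
          proof (cases "snd w = 0")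
            case True
            then show ?thesis using U w0 by (auto simp: proj_coord_def zero_prod_def)
          next
            case False
            then have "N < dist (fst w / snd w) 0"
              using 1 2 by (simp add: dist_fls_divide field_simps)
            then have "fst w / snd w \<in> V" using M[of "fst w / snd w"] by (auto simp: N_def)
            then show ?thesis using False by (auto simp: proj_coord_def V_def)
          qed
        qed
        ultimately show ?thesis by blast
      qed
    qed
    then show "openin projective_line U" by (simp add: iff)
  }
qed

end

theory Submission
  imports Defs
begin

text \<open>
  The Cantor line is self-similar. The interval $[1_+, +\infty]$ consists of $+\infty$ and the disjoint
  open intervals $[(c-1)_+, c_-]$, $c \ge 2$, and each of these is an order-isomorphic copy of the
  whole interval under the branch $x \mapsto c - 1/x$, with $+\infty$ going to $c_-$. Iterating gives
  every point a digit sequence $c_1, c_2, \dots$, which is finite exactly for $+\infty$ and the points $r_-$.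
  On the side of power series a branch becomes $f \mapsto [c]_q - q^{c-1}/f$ on the series with
  constant coefficient $1$, and the translation $x \mapsto x + 1$ becomes $f \mapsto q f + 1$. The rest
  of the proof uses only these two functional equations (\<open>cantor_fps_branch\<close>, \<open>Phi_translate\<close>) and
  the value at $+\infty$.

  An image of first digit $c$ begins with $c - 1$ coefficients $1$ followed by a $0$, and the image of
  $+\infty$ has only coefficients $1$. So, modulo any $m \ge 2$, the image determines the first digit
  and the image of the rest, and hence all digits. That digits determine the point on
  $[1_+, +\infty]$ is a finite induction for $r_-$ (\<open>cantor_fps_RatMinus_inject\<close>); for the other points it
  follows because removing digits expands distances (\<open>expanding_pairs_eq\<close>). Translations carry this
  to all points, whence injectivity.

  Since a branch raises the order of agreement of two series by $c - 1 \ge 1$, nearby points have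
  images that agree to high order (\<open>cantor_fps_locally_constant\<close>), and near $-\infty$ the images have
  poles of high order (\<open>Phi_near_NegInf\<close>). So $\Phi_m$ is continuous into the one-point
  compactification. The Cantor line is compact, because every subset has a least upper bound, and
  the target is Hausdorff, because closed balls of Laurent series over a finite ring are compact; so
  $\Phi_m$ is a closed map. For prime $m$ the target is the projective line.

  For $m = 2$ a coefficient other than $1$ is $0$, so every series with constant coefficient $1$
  either is the image of $+\infty$ or has a first digit. Approximating its tail by an image shows that
  the range is dense (\<open>cantor_fps_dense\<close>); being closed, it is everything.
\<close>

section \<open>Hirzebruch--Jung expansions\<close>

lemma hj_frac_Cons: "cs \<noteq> [] \<Longrightarrow> hj_frac (c # cs) = real c - 1 / hj_frac cs"
  by (cases cs) auto

lemma hj_frac_gt_1: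
  assumes "cs \<noteq> []" "\<forall>c\<in>set cs. 2 \<le> c"
  shows "hj_frac cs > 1"
  using assms
proof (induction cs)
  case (Cons c cs)
  show ?case
  proof (cases "cs = []")
    case False
    with Cons have "hj_frac cs > 1" by simp
    then have "1 / hj_frac cs < 1" by simp
    with False Cons.prems show ?thesis by (simp add: hj_frac_Cons)
  qed (use Cons.prems in simp)
qed simp

lemma hj_frac_snoc_le:
  assumes "cs \<noteq> []" "\<forall>c\<in>set cs. 2 \<le> c" "2 \<le> d"
  shows "hj_frac (cs @ [d]) \<le> hj_frac cs"
  using assms
proof (induction cs)
  case (Cons c cs)
  show ?case
  proof (cases "cs = []")
    case False
    with Cons have "hj_frac (cs @ [d]) \<le> hj_frac cs" by simp
    moreover have "hj_frac (cs @ [d]) > 1"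
      using Cons.prems by (intro hj_frac_gt_1) auto
    ultimately have "1 / hj_frac cs \<le> 1 / hj_frac (cs @ [d])"
      by (intro divide_left_mono mult_pos_pos) auto
    with False show ?thesis by (simp add: hj_frac_Cons)
  qed simp
qed simp

text \<open>
  The map $x \mapsto c - 1/x$ has derivative $1/x^2 \le 1$ on $[1, \infty)$, with equality only at
  $1$; so two distinct points cannot share all their digits. Indeed each digit removed multiplies
  the distance by \<open>a' * b'\<close>, and this factor stays away from $1$ because \<open>a'\<close> and \<open>b'\<close> cannot
  both be near $1$. The distance would grow geometrically, while points with the same first digit
  have distance less than $1$. The lemma shows that an expansion converges to the number whose
  digits it lists, and that the real value of a point is determined by its image under $\Phi_m$.
\<close>

lemma expanding_pairs_eq:
  fixes R :: "real \<Rightarrow> real \<Rightarrow> bool"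
  assumes step: "\<And>a b. R a b \<Longrightarrow>
      \<exists>c a' b'. 1 \<le> a' \<and> 1 \<le> b' \<and> a = c - 1 / a' \<and> b = c - 1 / b' \<and> R a' b'"
    and "R a b"
  shows "a = b"
proof (rule ccontr)
  assume "a \<noteq> b"
  define \<delta> where "\<delta> = \<bar>a - b\<bar>"
  have "\<delta> > 0" using \<open>a \<noteq> b\<close> by (simp add: \<delta>_def)
  have "\<exists>a b. R a b \<and> (1 + \<delta>) ^ n * \<delta> \<le> \<bar>a - b\<bar>" for n
  proof (induction n)
    case 0
    show ?case using \<open>R a b\<close> by (auto simp: \<delta>_def)
  next
    case (Suc n)
    then obtain a b where ab: "R a b" "(1 + \<delta>) ^ n * \<delta> \<le> \<bar>a - b\<bar>" by blast
    obtain c a' b' where s: "1 \<le> a'" "1 \<le> b'" "a = c - 1 / a'" "b = c - 1 / b'" "R a' b'"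
      using step[OF ab(1)] by blast
    have "a' - b' = a' * b' * (a - b)"
      using s(1,2) unfolding s(3,4) by (simp add: field_simps)
    then have eq: "\<bar>a' - b'\<bar> = a' * b' * \<bar>a - b\<bar>"
      using s(1,2) by (simp add: abs_mult)
    have "1 \<le> (1 + \<delta>) ^ n"
      using \<open>\<delta> > 0\<close> by (intro one_le_power) simp
    then have "\<delta> \<le> (1 + \<delta>) ^ n * \<delta>"
      using \<open>\<delta> > 0\<close> by simp
    with ab(2) have "\<delta> \<le> \<bar>a - b\<bar>" by linarith
    moreover have "1 * \<bar>a - b\<bar> \<le> a' * b' * \<bar>a - b\<bar>"
      using s(1,2) mult_mono[of 1 a' 1 b'] by (intro mult_right_mono) auto
    ultimately have "\<delta> \<le> \<bar>a' - b'\<bar>"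
      unfolding eq mult_1 by (rule order.trans)
    \<comment> \<open>the points \<open>a'\<close>, \<open>b' \<ge> 1\<close> have distance at least \<open>\<delta>\<close>, so the larger one is at least \<open>1 + \<delta>\<close>\<close>
    then have "1 + \<delta> \<le> max a' b'"
      using s(1,2) by (auto simp: max_def abs_if split: if_splits)
    also have "\<dots> \<le> a' * b'"
      using s(1,2) mult_left_mono[of 1 b' a'] mult_right_mono[of 1 a' b'] by auto
    finally have "(1 + \<delta>) * ((1 + \<delta>) ^ n * \<delta>) \<le> a' * b' * \<bar>a - b\<bar>"
      using ab(2) \<open>\<delta> > 0\<close> s(1,2) by (intro mult_mono) auto
    then show ?case
      using s(5) eq by (intro exI[of _ a'] exI[of _ b']) (simp add: mult_ac)
  qed
  moreover have "\<bar>a - b\<bar> < 1" if "R a b" for a b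
  proof -
    obtain c a' b' where "1 \<le> a'" "1 \<le> b'" "a = c - 1 / a'" "b = c - 1 / b'"
      using step[OF \<open>R a b\<close>] by blast
    moreover from this have "0 < 1 / a'" "1 / a' \<le> 1" "0 < 1 / b'" "1 / b' \<le> 1"
      by auto
    ultimately show ?thesis by linarith
  qed
  moreover obtain n where "1 / \<delta> < (1 + \<delta>) ^ n"
    using real_arch_pow[of "1 + \<delta>" "1 / \<delta>"] \<open>\<delta> > 0\<close> by auto
  ultimately show False
    using \<open>\<delta> > 0\<close> by (smt (verit, best) pos_divide_less_eq)
qed

text \<open>
  Since the tails of an expansion are at most its second digit, \<open>x\<close> stays strictly below the
  first digit. Hence the first digit is $\lfloor x \rfloor + 1$, and the tails converge as well.
\<close>

lemma hj_expansion_tail: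
  assumes "hj_expansion x c"
  shows "real (c 0) - 1 \<le> x" "x < real (c 0)" "hj_expansion (1 / (real (c 0) - x)) (\<lambda>j. c (Suc j))"
proof -
  define t where "t N = hj_frac (map (\<lambda>j. c (Suc j)) [0..<Suc N])" for N
  have c2: "2 \<le> c j" for j using assms by (simp add: hj_expansion_def)
  have eq: "hj_frac (map c [0..<Suc (Suc N)]) = real (c 0) - 1 / t N" for N
    unfolding map_upt_Suc[of c "Suc N"] t_def by (rule hj_frac_Cons) simp
  have "(\<lambda>N. hj_frac (map c [0..<Suc (Suc N)])) \<longlonglongrightarrow> x"
    by (rule LIMSEQ_Suc) (use assms in \<open>simp add: hj_expansion_def\<close>)
  then have "(\<lambda>N. real (c 0) - 1 / t N) \<longlonglongrightarrow> x" by (simp only: eq)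
  from tendsto_diff[OF tendsto_const[of "real (c 0)"] this]
  have lim: "(\<lambda>N. 1 / t N) \<longlonglongrightarrow> real (c 0) - x" by simp
  have t1: "1 < t N" for N unfolding t_def by (rule hj_frac_gt_1) (auto simp: c2)
  have "t N \<le> c (Suc 0)" for N
  proof (cases N)
    case (Suc M)
    have "t N = real (c (Suc 0)) - 1 / hj_frac (map (\<lambda>j. c (Suc (Suc j))) [0..<Suc M])"
      unfolding t_def Suc map_upt_Suc[of _ "Suc M"] by (rule hj_frac_Cons) simp
    moreover have "hj_frac (map (\<lambda>j. c (Suc (Suc j))) [0..<Suc M]) > 1"
      by (rule hj_frac_gt_1) (auto simp: c2)
    ultimately show ?thesis by (simp add: divide_nonneg_nonneg)
  qed (simp add: t_def)
  then have "1 / c (Suc 0) \<le> 1 / t N" for N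
    using t1[of N] c2[of "Suc 0"] by (intro divide_left_mono) auto
  then have "1 / c (Suc 0) \<le> real (c 0) - x"
    using LIMSEQ_le_const[OF lim] by blast
  moreover have "1 / c (Suc 0) > 0" using c2[of "Suc 0"] by simp
  ultimately have pos: "real (c 0) - x > 0" by linarith
  have "1 / t N \<le> 1" for N using t1[of N] by simp
  then have "real (c 0) - x \<le> 1"
    using LIMSEQ_le_const2[OF lim] by blast
  then show "real (c 0) - 1 \<le> x" by simp
  show "x < real (c 0)" using pos by simp
  have "(\<lambda>N. 1 / (1 / t N)) \<longlonglongrightarrow> 1 / (real (c 0) - x)"
    using pos by (intro tendsto_divide lim tendsto_const) simp
  then show "hj_expansion (1 / (real (c 0) - x)) (\<lambda>j. c (Suc j))"
    by (simp add: hj_expansion_def c2 t_def del: upt_Suc)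
qed

lemma hj_expansion_ge_1:
  assumes "hj_expansion x c"
  shows "1 \<le> x"
proof -
  have "2 \<le> c 0" using assms by (simp add: hj_expansion_def)
  with hj_expansion_tail(1)[OF assms] show ?thesis by linarith
qed

lemma hj_expansion_Cons:
  assumes "hj_expansion x c" "2 \<le> d"
  shows "hj_expansion (real d - 1 / x) (case_nat d c)"
proof -
  have "x \<noteq> 0" using hj_expansion_ge_1[OF assms(1)] by simp
  then have "(\<lambda>N. real d - 1 / hj_frac (map c [0..<Suc N])) \<longlonglongrightarrow> real d - 1 / x"
    using assms(1) by (intro tendsto_intros) (auto simp: hj_expansion_def)
  also have "(\<lambda>N. real d - 1 / hj_frac (map c [0..<Suc N]))
      = (\<lambda>N. hj_frac (map (case_nat d c) [0..<Suc (Suc N)]))"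
    unfolding map_upt_Suc[of _ "Suc _"] by (subst hj_frac_Cons) auto
  finally have "(\<lambda>N. hj_frac (map (case_nat d c) [0..<Suc N])) \<longlonglongrightarrow> real d - 1 / x"
    by (rule LIMSEQ_imp_Suc)
  then show ?thesis
    using assms by (auto simp: hj_expansion_def split: nat.split)
qed

lemma hj_expansion_unique:
  assumes "hj_expansion x c" "hj_expansion x d"
  shows "c = d"
proof
  fix n
  from assms show "c n = d n"
  proof (induction n arbitrary: x c d)
    case (0 x c d)
    then show ?case using hj_expansion_tail(1,2)[of x c] hj_expansion_tail(1,2)[of x d] by linarith
  next
    case (Suc n x c d)
    have "c 0 = d 0"
      using Suc.prems hj_expansion_tail(1,2)[of x c] hj_expansion_tail(1,2)[of x d] by linarith
    with Suc.prems show ?case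
      using hj_expansion_tail(3)[of x c] hj_expansion_tail(3)[of x d]
      by (intro Suc.IH[of _ "\<lambda>j. c (Suc j)" "\<lambda>j. d (Suc j)"]) auto
  qed
qed

lemma hj_expansion_converges:
  assumes "\<And>j. 2 \<le> c j"
  shows "\<exists>x. hj_expansion x c"
proof -
  have "hj_frac (map c [0..<Suc (Suc N)]) \<le> hj_frac (map c [0..<Suc N])" for N
    using hj_frac_snoc_le[of "map c [0..<Suc N]" "c (Suc N)"] assms by simp
  then have "decseq (\<lambda>N. hj_frac (map c [0..<Suc N]))"
    by (intro decseq_SucI)
  moreover have "1 \<le> hj_frac (map c [0..<Suc N])" for N
    using assms by (intro less_imp_le hj_frac_gt_1) auto
  ultimately obtain x where "(\<lambda>N. hj_frac (map c [0..<Suc N])) \<longlonglongrightarrow> x"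
    using decseq_convergent[of _ 1] by blast
  then show ?thesis using assms by (auto simp: hj_expansion_def)
qed

text \<open>
  The digits are read off greedily. Some number \<open>y\<close> has these digits as its expansion, and
  \<open>expanding_pairs_eq\<close> identifies it with \<open>x\<close>.
\<close>

lemma hj_expansion_exists:
  assumes "1 \<le> x"
  shows "\<exists>c. hj_expansion x c"
proof -
  define dig where "dig t = nat \<lfloor>t\<rfloor> + 1" for t :: real
  define nxt where "nxt t = 1 / (real (dig t) - t)" for t :: real
  define c where "c t n = dig ((nxt ^^ n) t)" for t n
  have dig: "real (dig t) - 1 \<le> t" "t < real (dig t)" "2 \<le> dig t" if "1 \<le> t" for t
    using that unfolding dig_def by linarith+
  have nxt: "1 \<le> nxt t" if "1 \<le> t" for t
    using dig[OF that] by (simp add: nxt_def)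
  have "1 \<le> (nxt ^^ n) t" if "1 \<le> t" for n t
    using that by (induction n) (auto intro: nxt)
  then have c2: "2 \<le> c t j" if "1 \<le> t" for t j
    using that dig by (simp add: c_def)
  obtain y where y: "hj_expansion y (c x)"
    using hj_expansion_converges[of "c x"] c2[OF assms] by blast
  define R where "R a b \<longleftrightarrow> 1 \<le> a \<and> hj_expansion b (c a)" for a b
  have "x = y"
  proof (rule expanding_pairs_eq[of R])
    show "R x y" using assms y by (simp add: R_def)
    fix a b assume "R a b"
    then have a: "1 \<le> a" and b: "hj_expansion b (c a)" by (auto simp: R_def)
    have c0: "c a 0 = dig a" by (simp add: c_def)
    have cS: "(\<lambda>j. c a (Suc j)) = c (nxt a)"
      by (simp add: c_def fun_eq_iff funpow_Suc_right del: funpow.simps)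
    let ?b = "1 / (real (dig a) - b)"
    have "hj_expansion ?b (c (nxt a))"
      using hj_expansion_tail(3)[OF b] by (simp only: c0 cS)
    moreover have "1 \<le> ?b" using hj_expansion_ge_1 calculation by blast
    ultimately show "\<exists>d a' b'. 1 \<le> a' \<and> 1 \<le> b' \<and> a = d - 1 / a' \<and> b = d - 1 / b' \<and> R a' b'"
      using a nxt[OF a] by (intro exI[of _ "real (dig a)"] exI[of _ "nxt a"] exI[of _ ?b])
        (auto simp: R_def nxt_def)
  qed
  with y show ?thesis by blast
qed

text \<open>
  Writing $a/b = c - b'/b$ with $c = \lceil a/b \rceil$ makes the denominator drop from $b$ to
  $b' < b$. This is the finite Hirzebruch--Jung expansion, in the form of an induction rule.
\<close>

lemma rat_hj_induct [consumes 1, case_names integer step]: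
  fixes r :: rat
  assumes "1 < r"
    and integer: "\<And>c. 2 \<le> c \<Longrightarrow> P (of_nat c)"
    and step: "\<And>c r. 2 \<le> c \<Longrightarrow> 1 < r \<Longrightarrow> P r \<Longrightarrow> P (of_nat c - 1 / r)"
  shows "P r"
proof -
  have "P (of_int a / of_int b)" if "0 < b" "b < a" for a b :: int
    using that
  proof (induction "nat b" arbitrary: a b rule: less_induct)
    case (less b a)
    define c where "c = (a + b - 1) div b"
    define b' where "b' = c * b - a"
    have c: "a \<le> c * b" "c * b < a + b"
      using less.prems div_mult_mod_eq[of "a + b - 1" b] pos_mod_bound[of b "a + b - 1"]
        pos_mod_sign[of b "a + b - 1"] unfolding c_def by linarith+
    then have "1 < c" using less.prems by (smt (verit) mult_less_cancel_right1)
    then have c2: "2 \<le> nat c" by simp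
    show ?case
    proof (cases "b' = 0")
      case True
      then have "a = c * b" by (simp add: b'_def)
      then have "of_int a / of_int b = (of_nat (nat c) :: rat)"
        using less.prems \<open>1 < c\<close> by simp
      with integer[OF c2] show ?thesis by simp
    next
      case False
      with c have b': "0 < b'" "b' < b" by (auto simp: b'_def)
      then have "P (of_int b / of_int b')"
        using less.prems by (intro less.hyps) auto
      moreover have "1 < (of_int b / of_int b' :: rat)" using b' by simp
      ultimately have "P (of_nat (nat c) - 1 / (of_int b / of_int b'))"
        by (intro step c2)
      also have "of_nat (nat c) - 1 / (of_int b / of_int b') = (of_int a / of_int b :: rat)"
        using less.prems \<open>1 < c\<close> by (simp add: b'_def field_simps)
      finally show ?thesis .
    qed
  qed
  moreover obtain a b where "r = of_int a / of_int b" "0 < b"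
    by (metis Fract_of_int_quotient quotient_of_unique)
  ultimately show ?thesis using \<open>1 < r\<close> by simp
qed

lemma hj_expansion_rat_Cons:
  assumes "hj_expansion_rat r cs" "2 \<le> c"
  shows "hj_expansion_rat (of_nat c - 1 / r) (c # cs)"
  using assms by (auto simp: hj_expansion_rat_def hj_frac_Cons of_rat_diff of_rat_divide)

lemma hj_expansion_rat_exists: "1 < r \<Longrightarrow> \<exists>cs. hj_expansion_rat r cs"
proof (induction r rule: rat_hj_induct)
  case (integer c)
  then show ?case by (intro exI[of _ "[c]"]) (simp add: hj_expansion_rat_def)
next
  case (step c r)
  then show ?case using hj_expansion_rat_Cons by blast
qed

lemma hj_frac_inject:
  assumes "cs \<noteq> []" "ds \<noteq> []" "\<forall>c\<in>set cs. 2 \<le> c" "\<forall>d\<in>set ds. 2 \<le> d" "hj_frac cs = hj_frac ds"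
  shows "cs = ds"
  using assms
proof (induction cs arbitrary: ds)
  case (Cons c cs)
  obtain d ds' where ds: "ds = d # ds'" using Cons.prems by (cases ds) auto
  have head: "\<exists>t\<ge>0. t < 1 \<and> hj_frac (e # es) = real e - t \<and> (t = 0 \<longleftrightarrow> es = [])
      \<and> (es \<noteq> [] \<longrightarrow> t = 1 / hj_frac es)" if "\<forall>i\<in>set es. 2 \<le> i" for e es
  proof (cases "es = []")
    case False
    then have "hj_frac es > 1" using that by (rule hj_frac_gt_1)
    with False show ?thesis by (intro exI[of _ "1 / hj_frac es"]) (auto simp: hj_frac_Cons)
  qed auto
  obtain s where s: "0 \<le> s" "s < 1" "hj_frac (c # cs) = real c - s" "s = 0 \<longleftrightarrow> cs = []"
      "cs \<noteq> [] \<longrightarrow> s = 1 / hj_frac cs"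
    using head[of cs c] Cons.prems by auto
  obtain t where t: "0 \<le> t" "t < 1" "hj_frac (d # ds') = real d - t" "t = 0 \<longleftrightarrow> ds' = []"
      "ds' \<noteq> [] \<longrightarrow> t = 1 / hj_frac ds'"
    using head[of ds' d] Cons.prems ds by auto
  have "real c - s = real d - t" using Cons.prems s t ds by simp
  with s(1,2) t(1,2) have "c = d" by linarith
  with \<open>real c - s = real d - t\<close> have cd: "c = d" "s = t" by simp_all
  show ?case
  proof (cases "cs = []")
    case False
    then have "hj_frac cs = hj_frac ds'" "ds' \<noteq> []" using s t cd by auto
    then show ?thesis using Cons False ds cd by auto
  qed (use s t cd ds in auto)
qed simp

lemma hj_expansion_rat_unique: "hj_expansion_rat r cs \<Longrightarrow> hj_expansion_rat r ds \<Longrightarrow> cs = ds"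
  by (auto simp: hj_expansion_rat_def intro: hj_frac_inject)

section \<open>$q$-numbers as power series\<close>

lemma fps_X_power_dvd_iff:
  fixes f :: "'a :: comm_ring_1 fps"
  shows "fps_X ^ n dvd f \<longleftrightarrow> (\<forall>k<n. fps_nth f k = 0)"
proof
  assume "\<forall>k<n. fps_nth f k = 0"
  then have "f = fps_X ^ n * fps_shift n f"
    by (intro fps_ext) (simp add: fps_X_power_mult_nth)
  then show "fps_X ^ n dvd f" by (rule dvdI)
qed (auto simp: fps_X_power_mult_nth elim!: dvdE)

lemma fps_unit_inv_nth_0 [simp]: "fps_nth (fps_unit_inv f) 0 = 1"
  by (simp add: fps_unit_inv_def)

lemma fps_unit_inv_unique:
  assumes "fps_nth f 0 = 1" "f * g = 1"
  shows "fps_unit_inv f = g"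
proof -
  have "fps_unit_inv f = (f * g) * fps_unit_inv f" using assms by simp
  also have "\<dots> = g * (f * fps_unit_inv f)" by (simp add: mult_ac)
  finally show ?thesis using fps_unit_inv[OF assms(1)] by simp
qed

lemma fps_unit_mult_left_cancel:
  fixes f :: "'a :: comm_ring_1 fps"
  assumes "fps_nth f 0 = 1" "f * g = f * h"
  shows "g = h"
proof -
  have "(f * fps_unit_inv f) * g = (f * fps_unit_inv f) * h"
    using assms(2) by (metis mult.assoc mult.commute)
  then show ?thesis by (simp add: fps_unit_inv[OF assms(1)])
qed

lemma fps_unit_inv_cong:
  assumes "fps_nth f 0 = 1" "fps_nth g 0 = 1" "fps_X ^ n dvd f - g"
  shows "fps_X ^ n dvd fps_unit_inv f - fps_unit_inv g"
proof -
  have "fps_unit_inv f * (g * fps_unit_inv g) - (f * fps_unit_inv f) * fps_unit_inv g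
      = (f - g) * (- (fps_unit_inv f * fps_unit_inv g))"
    by (simp add: algebra_simps)
  then have "fps_unit_inv f - fps_unit_inv g = (f - g) * (- (fps_unit_inv f * fps_unit_inv g))"
    by (simp add: fps_unit_inv assms)
  then show ?thesis using assms(3) by (metis dvd_mult2)
qed

lemma fps_unit_inv_one_minus_X: "fps_unit_inv (1 - fps_X) = Abs_fps (\<lambda>_. 1 :: 'a :: comm_ring_1)"
proof (rule fps_unit_inv_unique)
  show "(1 - fps_X) * Abs_fps (\<lambda>_. 1) = (1 :: 'a fps)"
    by (rule fps_ext) (auto simp: left_diff_distrib)
qed simp

lemma q_int_nth: "fps_nth (q_int n) k = (if k < n then 1 else 0)"
  by (simp add: q_int_def fps_unit_inv_one_minus_X left_diff_distrib fps_X_power_mult_nth)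

lemma q_int_Suc: "q_int (Suc n) = 1 + fps_X * q_int n"
  by (rule fps_ext) (auto simp: q_int_nth)

lemma q_frac_Cons:
  "cs \<noteq> [] \<Longrightarrow> q_frac l (c # cs) = q_int c - fps_X ^ (c - 1) * fps_unit_inv (q_frac l cs)"
  by (cases cs) auto

lemma q_frac_nth_0:
  assumes "cs \<noteq> []" "\<forall>c\<in>set cs. 2 \<le> c" "\<And>c. 2 \<le> c \<Longrightarrow> fps_nth (l c) 0 = 1"
  shows "fps_nth (q_frac l cs) 0 = 1"
proof (cases cs)
  case (Cons c ds)
  then show ?thesis
    using assms by (cases "ds = []") (auto simp: q_frac_Cons q_int_nth fps_X_power_mult_nth)
qed (use assms in simp)

lemma q_frac_Cons_mult:
  assumes "cs \<noteq> []" "\<forall>c\<in>set cs. 2 \<le> c" "\<And>c. 2 \<le> c \<Longrightarrow> fps_nth (l c) 0 = 1"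
  shows "q_frac l (c # cs) * q_frac l cs = q_int c * q_frac l cs - fps_X ^ (c - 1)"
proof -
  have "q_frac l (c # cs) * q_frac l cs
      = q_int c * q_frac l cs - fps_X ^ (c - 1) * (q_frac l cs * fps_unit_inv (q_frac l cs))"
    by (simp add: q_frac_Cons assms(1) algebra_simps)
  also have "q_frac l cs * fps_unit_inv (q_frac l cs) = 1"
    using assms by (intro fps_unit_inv q_frac_nth_0)
  finally show ?thesis by simp
qed

text \<open>
  A discrepancy in the tail is multiplied by $q^{c-1}$ with $c \ge 2$, so each level of the
  continued fraction gains at least one correct coefficient.
\<close>

lemma q_frac_cong:
  assumes "\<And>j. 2 \<le> c j" "n \<le> N" "n \<le> M"
  shows "fps_X ^ Suc n dvd q_frac q_int (map c [0..<Suc N]) - q_frac q_int (map c [0..<Suc M])"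
  using assms
proof (induction n arbitrary: c N M)
  case (0 c N M)
  have "fps_nth (q_frac q_int (map c [0..<Suc K])) 0 = 1" for K
    using 0 by (intro q_frac_nth_0) (auto simp: q_int_nth)
  then show ?case by (simp only: fps_X_power_dvd_iff) simp
next
  case (Suc n c N M)
  obtain N' M' where NM: "N = Suc N'" "M = Suc M'" "n \<le> N'" "n \<le> M'"
    using Suc.prems(2,3) by (metis Suc_le_D Suc_le_mono)
  define t where "t K = q_frac q_int (map (\<lambda>j. c (Suc j)) [0..<Suc K])" for K
  have t0: "fps_nth (t K) 0 = 1" for K
    unfolding t_def using Suc.prems(1) by (intro q_frac_nth_0) (auto simp: q_int_nth)
  have eq: "q_frac q_int (map c [0..<Suc (Suc K)])
      = q_int (c 0) - fps_X ^ (c 0 - 1) * fps_unit_inv (t K)" for K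
    unfolding map_upt_Suc[of c "Suc K"] t_def by (rule q_frac_Cons) simp
  have "fps_X ^ Suc n dvd t M' - t N'"
    unfolding t_def using Suc.prems(1) NM by (intro Suc.IH) auto
  then have "fps_X ^ Suc n dvd fps_unit_inv (t M') - fps_unit_inv (t N')"
    by (intro fps_unit_inv_cong t0)
  moreover have "fps_X dvd (fps_X :: int fps) ^ (c 0 - 1)"
    using Suc.prems(1)[of 0] by (intro dvd_power) simp
  ultimately have "fps_X * fps_X ^ Suc n
      dvd fps_X ^ (c 0 - 1) * (fps_unit_inv (t M') - fps_unit_inv (t N'))"
    by (rule mult_dvd_mono[rotated])
  moreover have "fps_X ^ (c 0 - 1) * (fps_unit_inv (t M') - fps_unit_inv (t N'))
      = (q_int (c 0) - fps_X ^ (c 0 - 1) * fps_unit_inv (t N'))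
        - (q_int (c 0) - fps_X ^ (c 0 - 1) * fps_unit_inv (t M'))"
    by (simp add: right_diff_distrib)
  ultimately show ?case
    unfolding NM eq power_Suc by metis
qed

lemma q_real_ge1_tendsto:
  assumes "hj_expansion x c"
  shows "(\<lambda>N. q_frac q_int (map c [0..<Suc N])) \<longlonglongrightarrow> q_real_ge1 x"
proof -
  have c2: "\<And>j. 2 \<le> c j" using assms by (simp add: hj_expansion_def)
  let ?f = "\<lambda>N. q_frac q_int (map c [0..<Suc N])"
  have "?f \<longlonglongrightarrow> Abs_fps (\<lambda>k. fps_nth (?f k) k)"
  proof (rule tendsto_fpsI)
    fix k
    have "fps_nth (?f N) k = fps_nth (?f k) k" if "k \<le> N" for N
    proof -
      have "fps_nth (?f N - ?f k) k = 0"
        using q_frac_cong[of c k N k, OF c2 that order.refl]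
        unfolding fps_X_power_dvd_iff by blast
      then show ?thesis by (simp only: fps_sub_nth right_minus_eq)
    qed
    then show "\<forall>\<^sub>F N in sequentially. fps_nth (?f N) k = fps_nth (Abs_fps (\<lambda>k. fps_nth (?f k) k)) k"
      unfolding eventually_sequentially fps_nth_Abs_fps by blast
  qed
  moreover have "(THE c. hj_expansion x c) = c"
    using assms by (intro the_equality hj_expansion_unique)
  ultimately show ?thesis
    unfolding q_real_ge1_def Let_def by (simp only: limI)
qed

lemma tendsto_fps_mult:
  fixes f g :: "'b \<Rightarrow> 'a :: ring fps"
  assumes "(f \<longlongrightarrow> F) net" "(g \<longlongrightarrow> G) net"
  shows "((\<lambda>x. f x * g x) \<longlongrightarrow> F * G) net"
proof (rule tendsto_fpsI)
  fix n
  have "\<forall>\<^sub>F x in net. \<forall>k\<in>{..n}. fps_nth (f x) k = fps_nth F k"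
    using assms(1) by (intro eventually_ball_finite) (auto simp: tendsto_fps_iff)
  moreover have "\<forall>\<^sub>F x in net. \<forall>k\<in>{..n}. fps_nth (g x) k = fps_nth G k"
    using assms(2) by (intro eventually_ball_finite) (auto simp: tendsto_fps_iff)
  ultimately show "\<forall>\<^sub>F x in net. fps_nth (f x * g x) n = fps_nth (F * G) n"
    by eventually_elim (simp add: fps_mult_nth)
qed

lemma tendsto_fps_diff_const:
  fixes f :: "'b \<Rightarrow> 'a :: ring fps"
  assumes "(f \<longlongrightarrow> F) net"
  shows "((\<lambda>x. f x - c) \<longlongrightarrow> F - c) net"
proof (rule tendsto_fpsI)
  fix n
  from assms have "\<forall>\<^sub>F x in net. fps_nth (f x) n = fps_nth F n"
    by (simp add: tendsto_fps_iff)
  then show "\<forall>\<^sub>F x in net. fps_nth (f x - c) n = fps_nth (F - c) n"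
    by eventually_elim simp
qed

lemma q_real_ge1_nth_0:
  assumes "1 \<le> x"
  shows "fps_nth (q_real_ge1 x) 0 = 1"
proof -
  obtain c where c: "hj_expansion x c" using hj_expansion_exists[OF assms] by blast
  have "fps_nth (q_frac q_int (map c [0..<Suc N])) 0 = 1" for N
    using c by (intro q_frac_nth_0) (auto simp: q_int_nth hj_expansion_def)
  moreover have "\<forall>\<^sub>F N in sequentially.
      fps_nth (q_frac q_int (map c [0..<Suc N])) 0 = fps_nth (q_real_ge1 x) 0"
    using q_real_ge1_tendsto[OF c] unfolding tendsto_fps_iff by blast
  ultimately show ?thesis by (simp del: upt_Suc)
qed

lemma q_real_ge1_branch:
  assumes "1 \<le> x" "2 \<le> d"
  shows "q_real_ge1 (real d - 1 / x) * q_real_ge1 x = q_int d * q_real_ge1 x - fps_X ^ (d - 1)"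
proof -
  obtain c where c: "hj_expansion x c" using hj_expansion_exists[OF assms(1)] by blast
  let ?f = "\<lambda>N. q_frac q_int (map c [0..<Suc N])"
  let ?g = "\<lambda>N. q_frac q_int (map (case_nat d c) [0..<Suc N])"
  have f: "?f \<longlonglongrightarrow> q_real_ge1 x" by (rule q_real_ge1_tendsto[OF c])
  have g: "?g \<longlonglongrightarrow> q_real_ge1 (real d - 1 / x)"
    by (intro q_real_ge1_tendsto hj_expansion_Cons c assms(2))
  have lim: "(\<lambda>N. ?g (Suc N) * ?f N) \<longlonglongrightarrow> q_real_ge1 (real d - 1 / x) * q_real_ge1 x"
    by (rule tendsto_fps_mult[OF LIMSEQ_Suc[OF g] f])
  have eq: "?g (Suc N) * ?f N = q_int d * ?f N - fps_X ^ (d - 1)" for N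
  proof -
    have "map (case_nat d c) [0..<Suc (Suc N)] = d # map c [0..<Suc N]"
      unfolding map_upt_Suc[of _ "Suc N"] by simp
    moreover have "q_frac q_int (d # map c [0..<Suc N]) * ?f N = q_int d * ?f N - fps_X ^ (d - 1)"
      using c by (intro q_frac_Cons_mult) (auto simp: hj_expansion_def q_int_nth)
    ultimately show ?thesis by (simp only:)
  qed
  have "(\<lambda>N. q_int d * ?f N - fps_X ^ (d - 1)) \<longlonglongrightarrow> q_int d * q_real_ge1 x - fps_X ^ (d - 1)"
    by (intro tendsto_fps_diff_const tendsto_fps_mult f tendsto_const)
  then show ?thesis
    using lim unfolding eq by (rule LIMSEQ_unique[rotated])
qed

lemma q_left_gt1_eq:
  assumes "hj_expansion_rat r cs"
  shows "q_left_gt1 r = q_frac (\<lambda>c. q_int c - fps_X ^ (c - 1) * (1 - fps_X)) cs"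
proof -
  have "(THE cs. hj_expansion_rat r cs) = cs"
    using assms by (intro the_equality hj_expansion_rat_unique)
  then show ?thesis by (simp add: q_left_gt1_def)
qed

lemma left_entry_nth_0:
  "2 \<le> c \<Longrightarrow> fps_nth (q_int c - fps_X ^ (c - 1) * (1 - fps_X)) 0 = 1"
  by (simp add: q_int_nth)

lemma q_left_gt1_nth_0: "1 < r \<Longrightarrow> fps_nth (q_left_gt1 r) 0 = 1"
  using hj_expansion_rat_exists[of r] left_entry_nth_0
  by (auto simp: q_left_gt1_eq hj_expansion_rat_def intro!: q_frac_nth_0)

lemma q_left_gt1_of_nat:
  "2 \<le> c \<Longrightarrow> q_left_gt1 (of_nat c) = q_int c - fps_X ^ (c - 1) * (1 - fps_X)"
  by (subst q_left_gt1_eq[of _ "[c]"]) (auto simp: hj_expansion_rat_def)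

lemma q_left_gt1_branch:
  assumes "1 < r" "2 \<le> d"
  shows "q_left_gt1 (of_nat d - 1 / r) * q_left_gt1 r = q_int d * q_left_gt1 r - fps_X ^ (d - 1)"
proof -
  obtain cs where cs: "hj_expansion_rat r cs" using hj_expansion_rat_exists[OF assms(1)] by blast
  show ?thesis
    unfolding q_left_gt1_eq[OF cs] q_left_gt1_eq[OF hj_expansion_rat_Cons[OF cs assms(2)]]
    using cs left_entry_nth_0 by (intro q_frac_Cons_mult) (auto simp: hj_expansion_rat_def)
qed

text \<open>
  Raising the first digit by one is translation by one: this is what turns the recursion over
  digits into the rule $[x+1]_q = q [x]_q + 1$ on the initial range, where the rule is not part of
  the definition.
\<close>

lemma q_branch_shift:
  fixes f g h :: "int fps"
  assumes "2 \<le> d" "fps_nth f 0 = 1"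
    and "g * f = q_int d * f - fps_X ^ (d - 1)" "h * f = q_int (Suc d) * f - fps_X ^ d"
  shows "h = fps_X * g + 1"
proof -
  have "h * f = (1 + fps_X * q_int d) * f - fps_X * fps_X ^ (d - 1)"
    using assms by (simp add: q_int_Suc power_eq_if[of _ d])
  also have "\<dots> = fps_X * (q_int d * f - fps_X ^ (d - 1)) + f"
    by (simp add: algebra_simps)
  also have "\<dots> = fps_X * (g * f) + f"
    by (simp only: assms(3))
  finally have "f * h = f * (fps_X * g + 1)" by (simp add: algebra_simps)
  then show ?thesis by (rule fps_unit_mult_left_cancel[OF assms(2)])
qed

lemma q_real_ge1_plus_1:
  assumes "1 \<le> x"
  shows "q_real_ge1 (x + 1) = fps_X * q_real_ge1 x + 1"
proof -
  obtain c where c: "hj_expansion x c" using hj_expansion_exists[OF assms] by blast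
  define t where "t = 1 / (real (c 0) - x)"
  have c0: "2 \<le> c 0" using c by (simp add: hj_expansion_def)
  have t: "1 \<le> t" using hj_expansion_ge_1[OF hj_expansion_tail(3)[OF c]] by (simp add: t_def)
  have x: "x = real (c 0) - 1 / t" "x + 1 = real (Suc (c 0)) - 1 / t" by (simp_all add: t_def)
  show ?thesis
  proof (rule q_branch_shift[OF c0 q_real_ge1_nth_0[OF t]])
    show "q_real_ge1 x * q_real_ge1 t = q_int (c 0) * q_real_ge1 t - fps_X ^ (c 0 - 1)"
      unfolding x(1) by (rule q_real_ge1_branch[OF t c0])
    show "q_real_ge1 (x + 1) * q_real_ge1 t = q_int (Suc (c 0)) * q_real_ge1 t - fps_X ^ c 0"
      unfolding x(2) using q_real_ge1_branch[OF t, of "Suc (c 0)"] c0 by simp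
  qed
qed

lemma q_left_gt1_plus_1:
  assumes "1 < r"
  shows "q_left_gt1 (r + 1) = fps_X * q_left_gt1 r + 1"
  using assms
proof (induction r rule: rat_hj_induct)
  case (integer c)
  have "q_left_gt1 (of_nat c + 1) = q_int (Suc c) - fps_X ^ c * (1 - fps_X)"
    using q_left_gt1_of_nat[of "Suc c"] integer by (simp add: add.commute)
  also have "\<dots> = fps_X * (q_int c - fps_X ^ (c - 1) * (1 - fps_X)) + 1"
    using integer by (simp add: q_int_Suc power_eq_if[of _ c] algebra_simps)
  finally show ?case using integer by (simp add: q_left_gt1_of_nat)
next
  case (step c r)
  show ?case
  proof (rule q_branch_shift[OF step(1) q_left_gt1_nth_0[OF step(2)]])
    show "q_left_gt1 (of_nat c - 1 / r) * q_left_gt1 r = q_int c * q_left_gt1 r - fps_X ^ (c - 1)"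
      by (rule q_left_gt1_branch[OF step(2,1)])
    show "q_left_gt1 (of_nat c - 1 / r + 1) * q_left_gt1 r = q_int (Suc c) * q_left_gt1 r - fps_X ^ c"
      using q_left_gt1_branch[OF step(2), of "Suc c"] step(1) by (simp add: algebra_simps)
  qed
qed

lemma fls_X_mult_fls_X_inv_mult: "fls_X * (fls_X_inv * f) = (f :: 'a :: comm_ring_1 fls)"
  by (simp add: fls_X_times_conv_shift fls_X_inv_times_conv_shift)

lemma fps_to_fls_X_mult: "fps_to_fls (fps_X * f + 1) = fls_X * fps_to_fls f + (1 :: 'a :: comm_ring_1 fls)"
  by (intro fls_eqI) (auto simp: fls_X_times_conv_shift nat_diff_distrib)

lemma q_real_plus_1: "q_real (x + 1) = fls_X * q_real x + 1"
proof (cases "1 \<le> x")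
  case True
  then show ?thesis
    by (simp add: q_real.simps[of x] q_real.simps[of "x + 1"] q_real_ge1_plus_1 fps_to_fls_X_mult
        del: fps_to_fls_plus)
next
  case False
  then show ?thesis
    by (simp add: q_real.simps[of x] fls_X_mult_fls_X_inv_mult)
qed

lemma q_left_plus_1: "q_left (r + 1) = fls_X * q_left r + 1"
proof (cases "1 < r")
  case True
  then show ?thesis
    by (simp add: q_left.simps[of r] q_left.simps[of "r + 1"] q_left_gt1_plus_1 fps_to_fls_X_mult
        del: fps_to_fls_plus)
next
  case False
  then show ?thesis
    by (simp add: q_left.simps[of r] fls_X_mult_fls_X_inv_mult)
qed

section \<open>Reduction modulo $m$\<close>

definition fps_red :: "int fps \<Rightarrow> 'm :: nontriv mod_ring fps" where
  "fps_red f = Abs_fps (\<lambda>n. of_int (fps_nth f n))"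

lemma fps_nth_fps_red [simp]: "fps_nth (fps_red f) n = of_int (fps_nth f n)"
  by (simp add: fps_red_def)

lemma fps_red_mult: "fps_red (f * g) = fps_red f * fps_red g"
  by (rule fps_ext) (simp add: fps_mult_nth)

lemma fps_red_diff: "fps_red (f - g) = fps_red f - fps_red g"
  by (rule fps_ext) simp

lemma fps_red_X_power: "fps_red (fps_X ^ n) = fps_X ^ n"
  by (rule fps_ext) simp

lemma fls_red_fps_to_fls: "fls_red (fps_to_fls f) = fps_to_fls (fps_red f)"
  by (intro fls_eqI) simp

lemma fls_red_X_mult_plus_1: "fls_red (fls_X * f + 1) = fls_X * fls_red f + 1"
  by (intro fls_eqI) (simp add: fls_X_times_conv_shift)

section \<open>The order topology of the Cantor line\<close>

text \<open>
  The usual supremum argument: the supremum \<open>s\<close> of the points \<open>x\<close> whose ray \<open>{..x}\<close> is finitely covered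
  is itself such a point, and it cannot be exceeded. The order need not be dense, so the last step
  has to cope with a jump to the right of \<open>s\<close>.
\<close>

lemma compact_UNIV_if_lubs:
  assumes lub: "\<And>S :: 'a :: linorder_topology set.
      \<exists>s. (\<forall>x\<in>S. x \<le> s) \<and> (\<forall>u. (\<forall>x\<in>S. x \<le> u) \<longrightarrow> s \<le> u)"
  shows "compact (UNIV :: 'a set)"
proof (rule compactI)
  fix C :: "'a set set"
  assume op: "\<forall>U\<in>C. open U" and cover: "UNIV \<subseteq> \<Union>C"
  define A where "A = {x. \<exists>F\<subseteq>C. finite F \<and> {..x} \<subseteq> \<Union>F}"
  obtain s where ub: "\<And>x. x \<in> A \<Longrightarrow> x \<le> s" and least: "\<And>u. (\<And>x. x \<in> A \<Longrightarrow> x \<le> u) \<Longrightarrow> s \<le> u"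
    using lub[of A] by blast
  obtain U where U: "U \<in> C" "open U" "s \<in> U" using cover op by blast
  have extend: "y \<in> A" if x: "x \<in> A" and V: "V \<in> C" "{x<..y} \<subseteq> U \<union> V" for x y V
  proof -
    obtain F where F: "F \<subseteq> C" "finite F" "{..x} \<subseteq> \<Union>F"
      using x by (auto simp: A_def)
    have "{..y} \<subseteq> {..x} \<union> {x<..y}" by auto
    also have "{..x} \<union> {x<..y} \<subseteq> \<Union>F \<union> (U \<union> V)"
      by (rule Un_mono[OF F(3) V(2)])
    also have "\<Union>F \<union> (U \<union> V) = \<Union>(insert U (insert V F))" by auto
    finally have "{..y} \<subseteq> \<Union>(insert U (insert V F))" .
    moreover have "insert U (insert V F) \<subseteq> C" "finite (insert U (insert V F))"
      using F V(1) U(1) by auto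
    ultimately show ?thesis unfolding A_def mem_Collect_eq by metis
  qed
  have s: "s \<in> A"
  proof (cases "\<exists>a. a < s")
    case True
    then obtain a where a: "a < s" "{a<..s} \<subseteq> U" using open_left[OF U(2,3)] by blast
    then obtain x where "x \<in> A" "a < x" using least[of a] by (meson not_less)
    then show ?thesis using extend[of x U s] U(1) a(2) by force
  next
    case False
    then have "{..s} = {s}" by (auto simp: not_less intro: antisym)
    with U show ?thesis by (auto simp: A_def intro!: exI[of _ "{U}"])
  qed
  have "\<not> s < t" for t
  proof
    assume "s < t"
    then obtain b where b: "b > s" "{s..<b} \<subseteq> U" using open_right[OF U(2,3)] by blast
    obtain V where V: "V \<in> C" "b \<in> V" using cover by blast
    \<comment> \<open>a second set \<open>V\<close> catches \<open>b\<close> itself, which may be the immediate successor of \<open>s\<close>\<close>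
    have "{s<..b} \<subseteq> U \<union> V" using b V(2) by (force simp: le_less)
    with extend[OF s V(1)] have "b \<in> A" by blast
    with ub b(1) show False by (metis not_less)
  qed
  then have "{..s} = UNIV" by (auto simp: not_less)
  with s show "\<exists>F\<subseteq>C. finite F \<and> UNIV \<subseteq> \<Union>F" by (auto simp: A_def)
qed

lemma real_of_irrational_neq_of_rat [simp]:
  "real_of_irrational x \<noteq> of_rat r" "of_rat r \<noteq> real_of_irrational x"
  using real_of_irrational[of x] by (metis Rats_of_rat mem_Collect_eq)+

lemma cantor_val_mono: "x \<le> y \<Longrightarrow> cantor_val x \<le> cantor_val y"
  by (auto simp: less_eq_cantor_line_def)

lemma cantor_lub_exists:
  "\<exists>s :: cantor_line. (\<forall>x\<in>S. x \<le> s) \<and> (\<forall>u. (\<forall>x\<in>S. x \<le> u) \<longrightarrow> s \<le> u)"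
proof -
  define v where "v = Sup (cantor_val ` S)"
  have le: "cantor_val x \<le> v" if "x \<in> S" for x
    using that by (auto simp: v_def intro: Sup_upper)
  have ge: "v \<le> cantor_val u" if "\<And>x. x \<in> S \<Longrightarrow> x \<le> u" for u
    using that cantor_val_mono by (auto simp: v_def intro!: Sup_least)
  show ?thesis
  proof (cases v)
    case MInf
    have "x \<le> NegInf" if "x \<in> S" for x
      using le[OF that] MInf by (cases x) (auto simp: less_eq_cantor_line_def)
    moreover have "NegInf \<le> u" for u by (cases u) (auto simp: less_eq_cantor_line_def)
    ultimately show ?thesis by blast
  next
    case PInf
    have "x \<le> PosInf" for x by (cases x) (auto simp: less_eq_cantor_line_def)
    moreover have "PosInf \<le> u" if "\<And>x. x \<in> S \<Longrightarrow> x \<le> u" for u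
      using ge[OF that] PInf by (cases u) (auto simp: less_eq_cantor_line_def)
    ultimately show ?thesis by blast
  next
    case (real t)
    show ?thesis
    proof (cases "t \<in> \<rat>")
      case False
      then have t: "real_of_irrational (Abs_irrational t) = t" by (simp add: Abs_irrational_inverse)
      have lt: "of_rat q < t \<longleftrightarrow> of_rat q \<le> t" "t < of_rat q \<longleftrightarrow> t \<le> of_rat q" for q
        using False by (auto simp: order.order_iff_strict)
      have "x \<le> Irr (Abs_irrational t)" if "x \<in> S" for x
        using le[OF that] real t by (cases x) (auto simp: less_eq_cantor_line_def lt)
      moreover have "Irr (Abs_irrational t) \<le> u" if "\<And>x. x \<in> S \<Longrightarrow> x \<le> u" for u
        using ge[OF that] real t by (cases u) (auto simp: less_eq_cantor_line_def lt)
      ultimately show ?thesis by blast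
    next
      case True
      then obtain q where q: "t = of_rat q" by (auto elim: Rats_cases)
      have irr_less: "real_of_irrational z \<le> of_rat q \<Longrightarrow> real_of_irrational z < of_rat q"
        "of_rat q \<le> real_of_irrational z \<Longrightarrow> of_rat q < real_of_irrational z" for z
        by (simp_all add: order.strict_iff_order)
      have up: "x \<le> RatPlus q" if "x \<in> S" for x
        using le[OF that] real q
        by (cases x) (auto simp: less_eq_cantor_line_def of_rat_less of_rat_less_eq irr_less)
      show ?thesis
      proof (cases "RatPlus q \<in> S")
        case True
        with up show ?thesis by blast
      next
        case False
        have "x \<le> RatMinus q" if "x \<in> S" for x
        proof -
          have "x \<noteq> RatPlus q" using False that by blast
          then show ?thesis
            using le[OF that] real q
            by (cases x) (auto simp: less_eq_cantor_line_def of_rat_less of_rat_less_eq irr_less)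
        qed
        moreover have "RatMinus q \<le> u" if "\<And>x. x \<in> S \<Longrightarrow> x \<le> u" for u
          using ge[OF that] real q
          by (cases u) (auto simp: less_eq_cantor_line_def of_rat_less of_rat_less_eq irr_less)
        ultimately show ?thesis by blast
      qed
    qed
  qed
qed

lemma compact_UNIV_cantor_line: "compact (UNIV :: cantor_line set)"
  by (rule compact_UNIV_if_lubs) (rule cantor_lub_exists)

lemma cantor_le_simps [simp]:
  "RatPlus a \<le> RatPlus b \<longleftrightarrow> a \<le> b"
  "RatMinus a \<le> RatMinus b \<longleftrightarrow> a \<le> b"
  "RatPlus a \<le> RatMinus b \<longleftrightarrow> a < b"
  "RatMinus a \<le> RatPlus b \<longleftrightarrow> a \<le> b"
  "RatPlus a \<le> Irr x \<longleftrightarrow> of_rat a < real_of_irrational x"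
  "Irr x \<le> RatMinus b \<longleftrightarrow> real_of_irrational x < of_rat b"
  "x' \<le> PosInf" "NegInf \<le> x'" "\<not> PosInf \<le> RatMinus b" "\<not> RatPlus b \<le> NegInf"
  by (cases x'; auto simp: less_eq_cantor_line_def of_rat_less of_rat_less_eq)+

text \<open>
  There is nothing between $r_-$ and $r_+$. Hence the intervals $[r_+, s_-]$ are open.
\<close>

lemma RatMinus_less_iff: "RatMinus r < x \<longleftrightarrow> RatPlus r \<le> x"
  by (cases x) (auto simp: less_eq_cantor_line_def less_cantor_line_def)

lemma less_RatPlus_iff: "x < RatPlus r \<longleftrightarrow> x \<le> RatMinus r"
  by (cases x) (auto simp: less_eq_cantor_line_def less_cantor_line_def)

lemma open_RatPlus_atLeast: "open {RatPlus r..}"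
proof -
  have "{RatPlus r..} = {RatMinus r<..}" by (auto simp: RatMinus_less_iff)
  then show ?thesis by simp
qed

lemma open_RatPlus_RatMinus: "open {RatPlus r..RatMinus s}"
proof -
  have "{RatPlus r..RatMinus s} = {RatMinus r<..<RatPlus s}"
    by (auto simp: RatMinus_less_iff less_RatPlus_iff)
  then show ?thesis by simp
qed

section \<open>Translations and continued fraction branches\<close>

fun translate :: "int \<Rightarrow> cantor_line \<Rightarrow> cantor_line" where
  "translate k NegInf = NegInf"
| "translate k PosInf = PosInf"
| "translate k (Irr x) = Irr (Abs_irrational (real_of_irrational x + of_int k))"
| "translate k (RatMinus r) = RatMinus (r + of_int k)"
| "translate k (RatPlus r) = RatPlus (r + of_int k)"

lemma real_of_irrational_translate:
  "real_of_irrational (Abs_irrational (real_of_irrational x + of_int k)) = real_of_irrational x + of_int k"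
proof (rule Abs_irrational_inverse, rule CollectI, rule notI)
  assume "real_of_irrational x + of_int k \<in> \<rat>"
  then have "real_of_irrational x + of_int k - of_int k \<in> \<rat>" by (intro Rats_diff) auto
  then show False using real_of_irrational[of x] by simp
qed

lemma cantor_val_translate: "cantor_val (translate k x) = cantor_val x + ereal (of_int k)"
  by (cases x) (auto simp: real_of_irrational_translate of_rat_add)

lemma cantor_side_translate: "cantor_side (translate k x) = cantor_side x"
  by (cases x) auto

lemma translate_translate [simp]: "translate k (translate l x) = translate (k + l) x"
  by (rule cantor_val_side_inject)
    (auto simp: cantor_val_translate cantor_side_translate add_ac)

lemma translate_0 [simp]: "translate 0 x = x"
  by (rule cantor_val_side_inject) (auto simp: cantor_val_translate cantor_side_translate)

lemma translate_less_iff [simp]: "translate k x < translate k y \<longleftrightarrow> x < y"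
  unfolding less_cantor_line_def cantor_val_translate cantor_side_translate
  by (cases "cantor_val x"; cases "cantor_val y") auto

lemma tendsto_translate: "(translate k \<longlongrightarrow> translate k x) (nhds x)"
proof (rule order_tendstoI)
  fix a assume "a < translate k x"
  then have "translate k (translate (- k) a) < translate k x" by simp
  then have "translate (- k) a < x" unfolding translate_less_iff .
  then have "\<forall>\<^sub>F y in nhds x. translate (- k) a < y"
    using eventually_nhds_in_open[of "{translate (- k) a<..}" x] by simp
  then show "\<forall>\<^sub>F y in nhds x. a < translate k y"
  proof eventually_elim
    case (elim y)
    then have "translate k (translate (- k) a) < translate k y" unfolding translate_less_iff .
    then show ?case by simp
  qed
next
  fix a assume "translate k x < a"
  then have "translate k x < translate k (translate (- k) a)" by simp
  then have "x < translate (- k) a" unfolding translate_less_iff .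
  then have "\<forall>\<^sub>F y in nhds x. y < translate (- k) a"
    using eventually_nhds_in_open[of "{..<translate (- k) a}" x] by simp
  then show "\<forall>\<^sub>F y in nhds x. translate k y < a"
  proof eventually_elim
    case (elim y)
    then have "translate k y < translate k (translate (- k) a)" unfolding translate_less_iff .
    then show ?case by simp
  qed
qed

text \<open>
  The interval $[1_+, +\infty]$ is where the continued fractions live and where all values of
  $\Phi_m$ are power series with constant coefficient $1$.
\<close>

abbreviation cantor_ge1 :: "cantor_line set" where
  "cantor_ge1 \<equiv> {RatPlus 1..}"

lemma translate_into_cantor_ge1:
  assumes "x \<noteq> NegInf"
  shows "\<exists>n. \<forall>k\<ge>n. translate (int k) x \<in> cantor_ge1"
proof -
  obtain n where n: "ereal (2 - real n) \<le> cantor_val x"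
  proof (cases "cantor_val x")
    case (real t)
    obtain n where "2 - t < real n" using reals_Archimedean2 by blast
    then show ?thesis using real by (intro that[of n]) simp
  qed (use assms in \<open>cases x; auto intro: that[of 0]\<close>)+
  have "translate (int k) x \<in> cantor_ge1" if "n \<le> k" for k
  proof -
    have "ereal (2 - real n) + ereal (real k) \<le> cantor_val (translate (int k) x)"
      unfolding cantor_val_translate using n by (intro add_mono) auto
    moreover have "ereal 1 < ereal (2 - real n) + ereal (real k)" using that by simp
    ultimately have "ereal 1 < cantor_val (translate (int k) x)" by (rule less_le_trans[rotated])
    then show ?thesis by (simp add: less_eq_cantor_line_def)
  qed
  then show ?thesis by blast
qed

text \<open>
  The map $x \mapsto c - 1/x$ on $[1_+, +\infty]$, which sends $+\infty$ to $c_-$. Its image there is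
  the interval $[(c-1)_+, c_-]$ of all points with first digit $c$. The value at $-\infty$ is a dummy.
\<close>

fun hj_branch :: "nat \<Rightarrow> cantor_line \<Rightarrow> cantor_line" where
  "hj_branch c NegInf = NegInf"
| "hj_branch c PosInf = RatMinus (of_nat c)"
| "hj_branch c (Irr x) = Irr (Abs_irrational (real c - 1 / real_of_irrational x))"
| "hj_branch c (RatMinus r) = RatMinus (of_nat c - 1 / r)"
| "hj_branch c (RatPlus r) = RatPlus (of_nat c - 1 / r)"

abbreviation hj_cylinder :: "nat \<Rightarrow> cantor_line set" where
  "hj_cylinder c \<equiv> {RatPlus (of_nat c - 1)..RatMinus (of_nat c)}"

lemma real_of_irrational_branch:
  "real_of_irrational (Abs_irrational (real c - 1 / real_of_irrational x)) = real c - 1 / real_of_irrational x"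
proof (rule Abs_irrational_inverse, rule CollectI, rule notI)
  assume "real c - 1 / real_of_irrational x \<in> \<rat>"
  from Rats_divide[OF Rats_1 Rats_diff[OF Rats_of_nat this]]
  have "1 / (real c - (real c - 1 / real_of_irrational x)) \<in> \<rat>" .
  also have "1 / (real c - (real c - 1 / real_of_irrational x)) = real_of_irrational x" by simp
  finally show False using real_of_irrational[of x] by simp
qed

lemma hj_branch_val:
  assumes "x \<in> cantor_ge1" "x \<noteq> PosInf"
  obtains a where "1 \<le> a" "cantor_val x = ereal a" "cantor_val (hj_branch c x) = ereal (real c - 1 / a)"
    "cantor_side (hj_branch c x) = cantor_side x"
proof (cases x)
  case (Irr t)
  with assms show ?thesis
    by (intro that[of "real_of_irrational t"]) (auto simp: real_of_irrational_branch)
next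
  case (RatMinus r)
  with assms show ?thesis
    by (intro that[of "of_rat r"]) (auto simp: of_rat_diff of_rat_divide)
next
  case (RatPlus r)
  with assms show ?thesis
    by (intro that[of "of_rat r"]) (auto simp: of_rat_diff of_rat_divide)
qed (use assms in auto)

lemma hj_branch_strict_mono:
  assumes "x \<in> cantor_ge1" "y \<in> cantor_ge1" "x < y"
  shows "hj_branch c x < hj_branch c y"
proof -
  have "x \<noteq> PosInf" using assms(3) by (metis cantor_le_simps(7) not_less)
  then obtain a where a: "1 \<le> a" "cantor_val x = ereal a" "cantor_val (hj_branch c x) = ereal (real c - 1 / a)"
    "cantor_side (hj_branch c x) = cantor_side x" using hj_branch_val[OF assms(1)] by metis
  show ?thesis
  proof (cases "y = PosInf")
    case True
    with a show ?thesis by (simp add: less_cantor_line_def)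
  next
    case False
    then obtain b where b: "1 \<le> b" "cantor_val y = ereal b" "cantor_val (hj_branch c y) = ereal (real c - 1 / b)"
      "cantor_side (hj_branch c y) = cantor_side y" using hj_branch_val[OF assms(2)] by metis
    show ?thesis
      using assms(3) a(1) b(1) unfolding less_cantor_line_def a(2-4) b(2-4)
      by (auto simp: field_simps)
  qed
qed

lemma hj_branch_less_iff:
  assumes "x \<in> cantor_ge1" "y \<in> cantor_ge1"
  shows "hj_branch c x < hj_branch c y \<longleftrightarrow> x < y"
  using hj_branch_strict_mono[OF assms] hj_branch_strict_mono[OF assms(2,1)]
  by (metis less_asym linorder_less_linear)

lemma hj_branch_in_cylinder:
  assumes "x \<in> cantor_ge1"
  shows "hj_branch c x \<in> hj_cylinder c"
  using assms
  by (cases x) (auto simp: real_of_irrational_branch of_rat_diff)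

lemma hj_branch_surj:
  assumes "y \<in> hj_cylinder c"
  shows "\<exists>x\<in>cantor_ge1. hj_branch c x = y"
proof (cases y)
  case (Irr z)
  define t where "t = 1 / (real c - real_of_irrational z)"
  have z: "real c - 1 < real_of_irrational z" "real_of_irrational z < real c"
    using assms Irr by (auto simp: of_rat_diff)
  have "t \<notin> \<rat>"
  proof
    assume "t \<in> \<rat>"
    then have "real c - 1 / t \<in> \<rat>" by (intro Rats_diff Rats_divide) auto
    then show False using real_of_irrational[of z] z by (simp add: t_def)
  qed
  then have t: "real_of_irrational (Abs_irrational t) = t" by (simp add: Abs_irrational_inverse)
  have "1 < t" using z by (simp add: t_def)
  moreover have "hj_branch c (Irr (Abs_irrational t)) = y"
    using z by (simp add: t Irr) (simp add: t_def real_of_irrational_inverse)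
  ultimately show ?thesis by (intro bexI[of _ "Irr (Abs_irrational t)"]) (auto simp: t)
next
  case (RatMinus r)
  show ?thesis
  proof (cases "r = of_nat c")
    case True
    with RatMinus show ?thesis by (intro bexI[of _ PosInf]) auto
  next
    case False
    with RatMinus assms have "of_nat c - 1 < r" "r < of_nat c" by auto
    with RatMinus show ?thesis by (intro bexI[of _ "RatMinus (1 / (of_nat c - r))"]) auto
  qed
next
  case (RatPlus r)
  with assms have "of_nat c - 1 \<le> r" "r < of_nat c" by auto
  with RatPlus show ?thesis by (intro bexI[of _ "RatPlus (1 / (of_nat c - r))"]) auto
qed (use assms in auto)

lemma cantor_ge1_cases:
  assumes "x \<in> cantor_ge1"
  obtains (infinity) "x = PosInf" | (branch) c y where "2 \<le> c" "y \<in> cantor_ge1" "x = hj_branch c y"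
proof (cases "x = PosInf")
  case False
  have "\<exists>c\<ge>2. x \<in> hj_cylinder c"
  proof (cases x)
    case (Irr z)
    define c where "c = nat \<lfloor>real_of_irrational z\<rfloor> + 1"
    have "1 < real_of_irrational z" using assms Irr by auto
    moreover have "real_of_irrational z \<noteq> of_int \<lfloor>real_of_irrational z\<rfloor>"
      using real_of_irrational[of z] by (metis Rats_of_int mem_Collect_eq)
    ultimately have "2 \<le> c" "real c - 1 < real_of_irrational z" "real_of_irrational z < real c"
      unfolding c_def by linarith+
    then show ?thesis using Irr by (intro exI[of _ c]) (auto simp: of_rat_diff)
  next
    case (RatMinus r)
    define c where "c = nat \<lceil>r\<rceil>"
    have "1 < r" using assms RatMinus by auto
    then have "2 \<le> c" "of_nat c - 1 < r" "r \<le> of_nat c"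
      unfolding c_def by linarith+
    then show ?thesis using RatMinus by (intro exI[of _ c]) auto
  next
    case (RatPlus r)
    define c where "c = nat \<lfloor>r\<rfloor> + 1"
    have "1 \<le> r" using assms RatPlus by auto
    then have "2 \<le> c" "of_nat c - 1 \<le> r" "r < of_nat c"
      unfolding c_def by linarith+
    then show ?thesis using RatPlus by (intro exI[of _ c]) auto
  qed (use assms False in auto)
  then show ?thesis using hj_branch_surj that(2) by metis
qed (rule infinity)

text \<open>
  Restricted to $[1_+, +\infty]$, a branch is an order isomorphism onto an open interval, so its
  inverse \<open>g\<close> is continuous on that interval.
\<close>

lemma hj_branch_open_map:
  assumes x: "x \<in> cantor_ge1" and P: "\<forall>\<^sub>F y in nhds x. y \<in> cantor_ge1 \<longrightarrow> P y"
  shows "\<forall>\<^sub>F z in nhds (hj_branch c x). \<exists>y\<in>cantor_ge1. z = hj_branch c y \<and> P y"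
proof -
  define g where "g z = (SOME y. y \<in> cantor_ge1 \<and> z = hj_branch c y)" for z
  have g: "g z \<in> cantor_ge1" "z = hj_branch c (g z)" if "z \<in> hj_cylinder c" for z
    using someI_ex[of "\<lambda>y. y \<in> cantor_ge1 \<and> z = hj_branch c y"] hj_branch_surj[OF that]
    unfolding g_def by blast+
  have ev: "\<forall>\<^sub>F z in nhds (hj_branch c x). z \<in> hj_cylinder c"
    using hj_branch_in_cylinder[OF x] open_RatPlus_RatMinus by (rule eventually_nhds_in_open[rotated])
  have "(g \<longlongrightarrow> x) (nhds (hj_branch c x))"
  proof (rule order_tendstoI)
    fix a assume a: "a < x"
    show "\<forall>\<^sub>F z in nhds (hj_branch c x). a < g z"
    proof (cases "a \<in> cantor_ge1")
      case True
      then have "hj_branch c a < hj_branch c x" using hj_branch_less_iff x a by blast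
      then have "\<forall>\<^sub>F z in nhds (hj_branch c x). z \<in> {hj_branch c a<..}"
        by (intro eventually_nhds_in_open) auto
      with ev show ?thesis
      proof eventually_elim
        case (elim z)
        then have "hj_branch c a < hj_branch c (g z)" using g(2) by simp
        then show ?case using hj_branch_less_iff[OF True g(1)[OF elim(1)]] by blast
      qed
    next
      case False
      then have "a < y" if "y \<in> cantor_ge1" for y using that by auto
      with ev g(1) show ?thesis by (metis (no_types, lifting) eventually_mono)
    qed
  next
    fix a assume a: "x < a"
    then have A: "a \<in> cantor_ge1" using x by auto
    then have "hj_branch c x < hj_branch c a" using hj_branch_less_iff x a by blast
    then have "\<forall>\<^sub>F z in nhds (hj_branch c x). z \<in> {..<hj_branch c a}"
      by (intro eventually_nhds_in_open) auto
    with ev show "\<forall>\<^sub>F z in nhds (hj_branch c x). g z < a"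
    proof eventually_elim
      case (elim z)
      then have "hj_branch c (g z) < hj_branch c a" using g(2) by simp
      then show ?case using hj_branch_less_iff[OF g(1)[OF elim(1)] A] by blast
    qed
  qed
  with P have "\<forall>\<^sub>F z in nhds (hj_branch c x). g z \<in> cantor_ge1 \<longrightarrow> P (g z)"
    by (rule eventually_compose_filterlim)
  with ev show ?thesis
  proof eventually_elim
    case (elim z)
    then show ?case using g[of z] by blast
  qed
qed

section \<open>The map $\Phi_m$ on branches and translates\<close>

text \<open>
  The value of $\Phi_m$ as a power series; it is meaningful on $[1_+, +\infty]$ only.
\<close>

definition cantor_fps :: "cantor_line \<Rightarrow> 'm :: nontriv mod_ring fps" where
  "cantor_fps x = fls_regpart (the (Phi x))"

lemma q_real_eq_q_real_ge1 [simp]: "1 \<le> x \<Longrightarrow> q_real x = fps_to_fls (q_real_ge1 x)"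
  by (simp add: q_real.simps)

lemma q_left_eq_q_left_gt1 [simp]: "1 < r \<Longrightarrow> q_left r = fps_to_fls (q_left_gt1 r)"
  by (simp add: q_left.simps)

lemma cantor_fps_simps:
  "cantor_fps PosInf = fps_unit_inv (1 - fps_X)"
  "1 \<le> real_of_irrational t \<Longrightarrow> cantor_fps (Irr t) = fps_red (q_real_ge1 (real_of_irrational t))"
  "1 \<le> r \<Longrightarrow> cantor_fps (RatPlus r) = fps_red (q_real_ge1 (of_rat r))"
  "1 < r \<Longrightarrow> cantor_fps (RatMinus r) = fps_red (q_left_gt1 r)"
  by (simp_all add: cantor_fps_def fls_red_fps_to_fls)

lemma Phi_eq_cantor_fps:
  assumes "x \<in> cantor_ge1"
  shows "Phi x = Some (fps_to_fls (cantor_fps x))"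
  using assms by (cases x) (auto simp: cantor_fps_simps fls_red_fps_to_fls)

lemma cantor_fps_nth_0:
  assumes "x \<in> cantor_ge1"
  shows "fps_nth (cantor_fps x) 0 = 1"
  using assms by (cases x) (auto simp: cantor_fps_simps q_real_ge1_nth_0 q_left_gt1_nth_0)

lemma fps_red_branch:
  assumes "g * f = q_int c * f - fps_X ^ (c - 1)"
  shows "fps_red g * fps_red f = fps_red (q_int c) * fps_red f - fps_X ^ (c - 1)"
  using arg_cong[OF assms, of fps_red] by (simp add: fps_red_mult fps_red_diff fps_red_X_power)

lemma cantor_fps_branch_mult:
  assumes "x \<in> cantor_ge1" "2 \<le> c"
  shows "(cantor_fps (hj_branch c x) :: 'm :: nontriv mod_ring fps) * cantor_fps x
    = fps_red (q_int c) * cantor_fps x - fps_X ^ (c - 1)"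
proof (cases x)
  case PosInf
  let ?F = "cantor_fps :: cantor_line \<Rightarrow> 'm mod_ring fps"
  have "fps_red (1 - fps_X) = (1 - fps_X :: 'm mod_ring fps)"
    by (rule fps_ext) simp
  then have branch: "?F (hj_branch c x) = fps_red (q_int c) - fps_X ^ (c - 1) * (1 - fps_X)"
    using assms(2)
    by (simp add: PosInf cantor_fps_simps q_left_gt1_of_nat fps_red_diff[of "q_int c"] fps_red_mult fps_red_X_power)
  have "?F (hj_branch c x) * ?F x
      = fps_red (q_int c) * ?F x - fps_X ^ (c - 1) * ((1 - fps_X) * ?F x)"
    by (simp only: branch left_diff_distrib mult.assoc)
  also have "(1 - fps_X) * ?F x = 1"
    by (simp add: PosInf cantor_fps_simps fps_unit_inv)
  finally show ?thesis by simp
next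
  case (Irr t)
  then have t: "1 \<le> real_of_irrational t" using assms by simp
  then have "1 / real_of_irrational t \<le> 1" by simp
  then have "1 \<le> real c - 1 / real_of_irrational t" using assms(2) by linarith
  with t show ?thesis
    using q_real_ge1_branch[OF t assms(2)]
    by (simp add: Irr cantor_fps_simps real_of_irrational_branch fps_red_branch)
next
  case (RatPlus r)
  then have r: "1 \<le> r" using assms by simp
  then have "1 / r \<le> 1" by simp
  moreover have "2 \<le> (of_nat c :: rat)" using assms(2) by simp
  ultimately have "1 \<le> of_nat c - 1 / r" by linarith
  with r show ?thesis
    using q_real_ge1_branch[of "of_rat r" c] assms(2)
    by (simp add: RatPlus cantor_fps_simps of_rat_diff of_rat_divide fps_red_branch)
next
  case (RatMinus r)
  then have r: "1 < r" using assms by simp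
  then have "1 / r < 1" by simp
  moreover have "2 \<le> (of_nat c :: rat)" using assms(2) by simp
  ultimately have "1 < of_nat c - 1 / r" by linarith
  with r show ?thesis
    using q_left_gt1_branch[OF r assms(2)]
    by (simp add: RatMinus cantor_fps_simps fps_red_branch)
qed (use assms in simp)

lemma cantor_fps_branch:
  assumes "x \<in> cantor_ge1" "2 \<le> c"
  shows "(cantor_fps (hj_branch c x) :: 'm :: nontriv mod_ring fps)
    = fps_red (q_int c) - fps_X ^ (c - 1) * fps_unit_inv (cantor_fps x)"
proof (rule fps_unit_mult_left_cancel[OF cantor_fps_nth_0[OF assms(1)]])
  let ?F = "cantor_fps :: cantor_line \<Rightarrow> 'm mod_ring fps"
  have "?F x * (fps_red (q_int c) - fps_X ^ (c - 1) * fps_unit_inv (?F x))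
      = fps_red (q_int c) * ?F x - fps_X ^ (c - 1) * (?F x * fps_unit_inv (?F x))"
    by (simp add: algebra_simps)
  also have "?F x * fps_unit_inv (?F x) = 1"
    by (intro fps_unit_inv cantor_fps_nth_0 assms(1))
  also have "fps_red (q_int c) * ?F x - fps_X ^ (c - 1) * 1 = ?F (hj_branch c x) * ?F x"
    unfolding cantor_fps_branch_mult[OF assms] by simp
  finally show "?F x * ?F (hj_branch c x)
      = ?F x * (fps_red (q_int c) - fps_X ^ (c - 1) * fps_unit_inv (?F x))"
    by (simp only: mult.commute[of "?F x" "?F (hj_branch c x)"])
qed

text \<open>
  A point with first digit $c$ has the image $1 + q + \dots + q^{c-2} + 0 \cdot q^{c-1} + \cdots$.
  So the position of the first vanishing coefficient reveals the first digit, and this survives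
  reduction modulo any $m \ge 2$.
\<close>

lemma cantor_fps_branch_nth:
  assumes "x \<in> cantor_ge1" "2 \<le> c" "k < c"
  shows "fps_nth (cantor_fps (hj_branch c x)) k = (if k < c - 1 then 1 else 0)"
  using assms by (auto simp: cantor_fps_branch q_int_nth fps_X_power_mult_nth)

lemma cantor_fps_PosInf_nth: "fps_nth (cantor_fps PosInf) k = 1"
  by (simp add: cantor_fps_simps fps_unit_inv_one_minus_X)

lemma cantor_fps_PosInf_unique:
  fixes x :: cantor_line
  assumes "x \<in> cantor_ge1" "(cantor_fps x :: 'm :: nontriv mod_ring fps) = cantor_fps PosInf"
  shows "x = PosInf"
  using assms(1)
proof (cases x rule: cantor_ge1_cases)
  case (branch c y)
  have "fps_nth (cantor_fps x :: 'm mod_ring fps) (c - 1) = 0"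
    using branch cantor_fps_branch_nth[of y c "c - 1"] by simp
  then show ?thesis by (simp add: assms(2) cantor_fps_PosInf_nth)
qed

lemma cantor_fps_branch_inject:
  assumes "x \<in> cantor_ge1" "y \<in> cantor_ge1" "2 \<le> c" "2 \<le> d"
    and eq: "(cantor_fps (hj_branch c x) :: 'm :: nontriv mod_ring fps) = cantor_fps (hj_branch d y)"
  shows "c = d" "(cantor_fps x :: 'm mod_ring fps) = cantor_fps y"
proof -
  let ?F = "cantor_fps :: cantor_line \<Rightarrow> 'm mod_ring fps"
  have le: "d' \<le> c'" if "x' \<in> cantor_ge1" "y' \<in> cantor_ge1" "2 \<le> c'" "2 \<le> d'"
    "?F (hj_branch c' x') = ?F (hj_branch d' y')" for x' y' c' d'
  proof (rule ccontr)
    assume "\<not> d' \<le> c'"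
    with that(3) have "c' - 1 < d' - 1" "c' - 1 < c'" "c' - 1 < d'" by linarith+
    then have "fps_nth (?F (hj_branch c' x')) (c' - 1) = 0" "fps_nth (?F (hj_branch d' y')) (c' - 1) = 1"
      using that(1-4) by (simp_all add: cantor_fps_branch_nth)
    then show False using that(5) by simp
  qed
  show "c = d" using le[of x y c d] le[of y x d c] assms by simp
  with eq have mult: "fps_X ^ (c - 1) * fps_unit_inv (?F x) = fps_X ^ (c - 1) * fps_unit_inv (?F y)"
    using assms by (simp add: cantor_fps_branch)
  have "fps_nth (fps_unit_inv (?F x)) k = fps_nth (fps_unit_inv (?F y)) k" for k
    using arg_cong[OF mult, of "\<lambda>f. fps_nth f (k + (c - 1))"] by (simp add: fps_X_power_mult_nth)
  then have inv: "fps_unit_inv (?F x) = fps_unit_inv (?F y)" by (rule fps_ext)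
  have "fps_unit_inv (?F z) * ?F z = 1" if "z \<in> cantor_ge1" for z
    using fps_unit_inv[OF cantor_fps_nth_0[OF that, where ?'a = 'm]] by (simp only: mult.commute)
  then have inv_inv: "fps_unit_inv (fps_unit_inv (?F z)) = ?F z" if "z \<in> cantor_ge1" for z
    using that by (intro fps_unit_inv_unique) auto
  show "?F x = ?F y"
    using inv_inv[OF assms(1)] inv_inv[OF assms(2)] inv by metis
qed

text \<open>The $n$-fold iterate of $f \mapsto q f + 1$, that is $f \mapsto q^n f + [n]_q$.\<close>

definition fls_translate :: "nat \<Rightarrow> 'a :: comm_ring_1 fls \<Rightarrow> 'a fls" where
  "fls_translate n f = fls_shift (- int n) f + fps_to_fls (Abs_fps (\<lambda>k. if k < n then 1 else 0))"

lemma fls_nth_translate [simp]: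
  "fls_nth (fls_translate n f) k = fls_nth f (k - int n) + (if 0 \<le> k \<and> k < int n then 1 else 0)"
  by (auto simp: fls_translate_def nat_less_iff)

lemma fls_translate_Suc: "fls_translate (Suc n) f = fls_X * fls_translate n f + 1"
  by (intro fls_eqI) (auto simp: fls_X_times_conv_shift algebra_simps)

lemma fls_translate_0: "fls_translate 0 f = f"
  by (intro fls_eqI) simp

lemma Phi_translate_1: "Phi (translate 1 x) = map_option (\<lambda>f. fls_X * f + 1) (Phi x)"
proof (cases x)
  case PosInf
  have "fls_X * fps_to_fls (Abs_fps (\<lambda>_. 1)) + 1 = (fps_to_fls (Abs_fps (\<lambda>_. 1)) :: 'a mod_ring fls)"
    by (intro fls_eqI) (auto simp: fls_X_times_conv_shift)
  with PosInf show ?thesis by (simp add: fps_unit_inv_one_minus_X)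
qed (simp_all add: real_of_irrational_translate[of _ 1, simplified] of_rat_add
      q_real_plus_1 q_left_plus_1 fls_red_X_mult_plus_1)

lemma Phi_translate: "Phi (translate (int n) x) = map_option (fls_translate n) (Phi x)"
proof (induction n)
  case 0
  show ?case by (simp add: fls_translate_0[abs_def] option.map_ident)
next
  case (Suc n)
  have "translate (int (Suc n)) x = translate 1 (translate (int n) x)" by simp
  then show ?case
    by (simp only: Phi_translate_1 Suc.IH option.map_comp)
      (simp add: fls_translate_Suc comp_def)
qed

section \<open>Injectivity\<close>

text \<open>
  The points $r_-$ and $r_+$ have the same real value and are therefore treated apart. The digit
  sequence of $r_-$ is finite: removing the digits of $r$ leads to $+\infty$, the only point whose
  image has no vanishing coefficient.
\<close>

lemma cantor_fps_RatMinus_inject: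
  assumes "1 < r" "y \<in> cantor_ge1"
    and "(cantor_fps y :: 'm :: nontriv mod_ring fps) = cantor_fps (RatMinus r)"
  shows "y = RatMinus r"
proof -
  have lift: "y = hj_branch c x"
    if x: "x \<in> cantor_ge1" "2 \<le> c"
      and y: "y \<in> cantor_ge1" "(cantor_fps y :: 'm mod_ring fps) = cantor_fps (hj_branch c x)"
      and IH: "\<And>z. z \<in> cantor_ge1 \<Longrightarrow> (cantor_fps z :: 'm mod_ring fps) = cantor_fps x \<Longrightarrow> z = x"
    for c x y
    using y(1)
  proof (cases y rule: cantor_ge1_cases)
    case infinity
    have "hj_branch c x \<in> hj_cylinder c" by (rule hj_branch_in_cylinder[OF x(1)])
    moreover have "(1 :: rat) \<le> of_nat c - 1" using x(2) by (simp add: le_diff_eq)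
    ultimately have "hj_branch c x \<in> cantor_ge1"
      by (auto intro: order.trans[of "RatPlus 1" "RatPlus (of_nat c - 1)"])
    then have "hj_branch c x = PosInf"
      using cantor_fps_PosInf_unique y(2) infinity by metis
    then show ?thesis using infinity by simp
  next
    case (branch d z)
    have "d = c" "(cantor_fps z :: 'm mod_ring fps) = cantor_fps x"
      using cantor_fps_branch_inject[of z x d c] branch x y(2) by simp_all
    moreover from this IH branch(2) have "z = x" by blast
    ultimately show ?thesis using branch(3) by simp
  qed
  show ?thesis
    using assms
  proof (induction r arbitrary: y rule: rat_hj_induct)
    case (integer c)
    have "y = hj_branch c PosInf"
      using integer by (intro lift) (auto intro: cantor_fps_PosInf_unique)
    then show ?case by simp
  next
    case (step c r)
    have "y = hj_branch c (RatMinus r)"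
      using step by (intro lift) auto
    then show ?case by simp
  qed
qed

text \<open>
  The remaining points, irrationals and $r_+$, form a set \<open>S\<close> that is preserved by removing the
  first digit. Equal images on \<open>S\<close> have equal digits forever, hence equal real values.
\<close>

lemma cantor_fps_inject:
  assumes "x \<in> cantor_ge1" "y \<in> cantor_ge1"
    and "(cantor_fps x :: 'm :: nontriv mod_ring fps) = cantor_fps y"
  shows "x = y"
proof -
  let ?F = "cantor_fps :: cantor_line \<Rightarrow> 'm mod_ring fps"
  define S where "S = {x \<in> cantor_ge1. x \<noteq> PosInf \<and> (\<forall>r. x \<noteq> RatMinus r)}"
  define R where "R a b \<longleftrightarrow> (\<exists>x\<in>S. \<exists>y\<in>S. cantor_val x = ereal a \<and> cantor_val y = ereal b \<and> ?F x = ?F y)"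
    for a b
  have branch: "\<exists>c\<ge>2. \<exists>x'\<in>S. x = hj_branch c x'" if "x \<in> S" for x
  proof -
    have "x \<in> cantor_ge1" using that by (simp add: S_def)
    then show ?thesis
    proof (cases x rule: cantor_ge1_cases)
      case (branch c x')
      moreover from this have "x' \<in> S" using that by (cases x') (auto simp: S_def)
      ultimately show ?thesis by blast
    qed (use that in \<open>simp add: S_def\<close>)
  qed
  have real_eq: "a = b" if "R a b" for a b
  proof (rule expanding_pairs_eq[of R, OF _ that])
    fix a b assume "R a b"
    then obtain x y where xy: "x \<in> S" "y \<in> S" "cantor_val x = ereal a" "cantor_val y = ereal b" "?F x = ?F y"
      by (auto simp: R_def)
    obtain c x' where x': "2 \<le> c" "x' \<in> S" "x = hj_branch c x'" using branch[OF xy(1)] by blast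
    obtain d y' where y': "2 \<le> d" "y' \<in> S" "y = hj_branch d y'" using branch[OF xy(2)] by blast
    have eq: "c = d" "?F x' = ?F y'"
      using cantor_fps_branch_inject[of x' y' c d] x' y' xy(5) by (simp_all add: S_def)
    obtain a' where a': "1 \<le> a'" "cantor_val x' = ereal a'" "cantor_val x = ereal (real c - 1 / a')"
      using hj_branch_val[of x' c] x' by (auto simp: S_def)
    obtain b' where b': "1 \<le> b'" "cantor_val y' = ereal b'" "cantor_val y = ereal (real d - 1 / b')"
      using hj_branch_val[of y' d] y' by (auto simp: S_def)
    have "R a' b'" using x' y' a' b' eq by (auto simp: R_def)
    then show "\<exists>c a' b'. 1 \<le> a' \<and> 1 \<le> b' \<and> a = c - 1 / a' \<and> b = c - 1 / b' \<and> R a' b'"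
      using a' b' xy eq by (intro exI[of _ "real c"] exI[of _ a'] exI[of _ b']) auto
  qed
  have special: "u = v" if uv: "u \<in> cantor_ge1" "v \<in> cantor_ge1" "?F u = ?F v" "u \<notin> S" for u v
  proof -
    consider "u = PosInf" | r where "u = RatMinus r" using uv by (auto simp: S_def)
    then show ?thesis
    proof cases
      case 1
      then show ?thesis using cantor_fps_PosInf_unique uv by metis
    next
      case 2
      then have "1 < r" using uv(1) by simp
      then have "v = RatMinus r"
        using uv(2) by (rule cantor_fps_RatMinus_inject[where ?'m = 'm]) (simp add: uv(3) flip: 2)
      with 2 show ?thesis by simp
    qed
  qed
  show ?thesis
  proof (cases "x \<in> S \<and> y \<in> S")
    case True
    then obtain a b where ab: "cantor_val x = ereal a" "cantor_val y = ereal b"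
      by (cases x; cases y) (auto simp: S_def)
    with True assms(3) have "R a b" by (auto simp: R_def)
    then have "a = b" by (rule real_eq)
    with True ab show ?thesis
      by (cases x; cases y) (auto simp: S_def real_of_irrational_inject)
  next
    case False
    then show ?thesis using special[OF assms] special[OF assms(2,1) assms(3)[symmetric]] by blast
  qed
qed

lemma Phi_eq_None_iff: "Phi x = None \<longleftrightarrow> x = NegInf"
  by (cases x) auto

lemma inj_Phi: "inj (Phi :: cantor_line \<Rightarrow> 'm :: nontriv mod_ring fls option)"
proof (rule injI)
  fix x y assume eq: "(Phi x :: 'm mod_ring fls option) = Phi y"
  show "x = y"
  proof (cases "x = NegInf")
    case True
    then have "(Phi y :: 'm mod_ring fls option) = None" using eq by simp
    then show ?thesis by (simp only: Phi_eq_None_iff True)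
  next
    case False
    then have "y \<noteq> NegInf" using eq Phi_eq_None_iff by metis
    obtain m where m: "\<And>k. m \<le> k \<Longrightarrow> translate (int k) x \<in> cantor_ge1"
      using translate_into_cantor_ge1[OF False] by blast
    obtain n where n: "\<And>k. n \<le> k \<Longrightarrow> translate (int k) y \<in> cantor_ge1"
      using translate_into_cantor_ge1[OF \<open>y \<noteq> NegInf\<close>] by blast
    define k where "k = max m n"
    have k: "translate (int k) x \<in> cantor_ge1" "translate (int k) y \<in> cantor_ge1"
      using m n by (simp_all add: k_def)
    have "(Phi (translate (int k) x) :: 'm mod_ring fls option) = Phi (translate (int k) y)"
      by (simp only: Phi_translate eq)
    then have "(cantor_fps (translate (int k) x) :: 'm mod_ring fps) = cantor_fps (translate (int k) y)"
      unfolding Phi_eq_cantor_fps[OF k(1)] Phi_eq_cantor_fps[OF k(2)] by simp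
    then have "translate (int k) x = translate (int k) y"
      by (rule cantor_fps_inject[OF k])
    then have "translate (- int k) (translate (int k) x) = translate (- int k) (translate (int k) y)"
      by simp
    then show ?thesis by simp
  qed
qed

section \<open>Continuity\<close>

text \<open>
  A branch improves an approximation by at least one coefficient. Stated for an arbitrary series
  \<open>f\<close>, so that it serves both continuity (\<open>f\<close> an image) and density (\<open>f\<close> a prescribed value).
\<close>

lemma cantor_fps_branch_cong:
  fixes f :: "'m :: nontriv mod_ring fps"
  assumes "x \<in> cantor_ge1" "2 \<le> c" "fps_nth f 0 = 1" "fps_X ^ n dvd cantor_fps x - f"
  shows "fps_X ^ Suc n dvd
    cantor_fps (hj_branch c x) - (fps_red (q_int c) - fps_X ^ (c - 1) * fps_unit_inv f)"
proof -
  have "fps_X ^ n dvd f - cantor_fps x"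
    using assms(4) by (metis dvd_minus_iff minus_diff_eq)
  then have "fps_X ^ n dvd fps_unit_inv f - fps_unit_inv (cantor_fps x)"
    using assms(1,3) by (intro fps_unit_inv_cong cantor_fps_nth_0)
  moreover have "fps_X dvd (fps_X :: 'm mod_ring fps) ^ (c - 1)"
    using assms(2) by (intro dvd_power) simp
  ultimately have "fps_X * fps_X ^ n dvd
      fps_X ^ (c - 1) * (fps_unit_inv f - fps_unit_inv (cantor_fps x))"
    by (rule mult_dvd_mono[rotated])
  also have "fps_X ^ (c - 1) * (fps_unit_inv f - fps_unit_inv (cantor_fps x))
      = cantor_fps (hj_branch c x) - (fps_red (q_int c) - fps_X ^ (c - 1) * fps_unit_inv f)"
    by (simp add: cantor_fps_branch[OF assms(1,2)] right_diff_distrib)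
  finally show ?thesis by simp
qed

text \<open>
  Continuity on $[1_+, +\infty]$, one coefficient at a time: near $+\infty$ the first digit is
  large, and all coefficients before it are $1$; every other point lies in the image of a branch,
  which is an open map and raises the order of agreement.
\<close>

lemma cantor_fps_locally_constant:
  assumes "x \<in> cantor_ge1"
  shows "\<forall>\<^sub>F y in nhds x. y \<in> cantor_ge1 \<longrightarrow>
    fps_X ^ n dvd (cantor_fps y :: 'm :: nontriv mod_ring fps) - cantor_fps x"
  using assms
proof (induction n arbitrary: x)
  case (Suc n x)
  let ?F = "cantor_fps :: cantor_line \<Rightarrow> 'm mod_ring fps"
  from Suc.prems show ?case
  proof (cases x rule: cantor_ge1_cases)
    case infinity
    have "\<forall>\<^sub>F y in nhds x. y \<in> {RatPlus (of_nat (Suc n))..}"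
      by (intro eventually_nhds_in_open open_RatPlus_atLeast) (simp add: infinity)
    then show ?thesis
    proof (eventually_elim, intro impI)
      fix y assume y: "y \<in> {RatPlus (of_nat (Suc n))..}" "y \<in> cantor_ge1"
      show "fps_X ^ Suc n dvd ?F y - ?F x"
        using y(2)
      proof (cases y rule: cantor_ge1_cases)
        case (branch c z)
        have "RatPlus (of_nat (Suc n)) \<le> RatMinus (of_nat c)"
          using y(1) hj_branch_in_cylinder[OF branch(2), of c] unfolding branch(3)
          by (meson atLeastAtMost_iff atLeast_iff order.trans)
        then have "Suc n < c" by (simp del: of_nat_Suc)
        then show ?thesis
          unfolding fps_X_power_dvd_iff branch(3) infinity
          using branch by (auto simp: cantor_fps_branch_nth cantor_fps_PosInf_nth)
      qed (simp add: infinity)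
    qed
  next
    case (branch c x')
    have "\<forall>\<^sub>F z in nhds (hj_branch c x'). \<exists>y\<in>cantor_ge1.
        z = hj_branch c y \<and> fps_X ^ n dvd ?F y - ?F x'"
      using branch Suc.IH by (intro hj_branch_open_map) auto
    then show ?thesis
      unfolding branch(3)
    proof eventually_elim
      case (elim z)
      then obtain y where y: "y \<in> cantor_ge1" "z = hj_branch c y" "fps_X ^ n dvd ?F y - ?F x'"
        by blast
      have "fps_X ^ Suc n dvd ?F z - ?F (hj_branch c x')"
        unfolding y(2) cantor_fps_branch[OF branch(2,1)]
        using branch y by (intro cantor_fps_branch_cong cantor_fps_nth_0)
      then show ?case ..
    qed
  qed
qed simp

lemma Phi_eq_Some_translate:
  assumes "translate (int N) y \<in> cantor_ge1"
  obtains g :: "'m :: nontriv mod_ring fls"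
  where "Phi y = Some g" "fls_translate N g = fps_to_fls (cantor_fps (translate (int N) y))"
proof -
  have "map_option (fls_translate N) (Phi y :: 'm mod_ring fls option)
      = Some (fps_to_fls (cantor_fps (translate (int N) y)))"
    unfolding Phi_translate[symmetric] by (rule Phi_eq_cantor_fps[OF assms])
  then show ?thesis using that by (cases "Phi y") auto
qed

lemma fls_translate_eq_fps_agree:
  assumes "fls_translate N f = fps_to_fls F" "fls_translate N g = fps_to_fls G"
    and "fps_X ^ n dvd F - G" "k + int N < int n"
  shows "fls_nth f k = fls_nth g k"
proof -
  have "fls_nth (fps_to_fls F) (k + int N) = fls_nth (fps_to_fls G) (k + int N)"
  proof (cases "0 \<le> k + int N")
    case True
    with assms(4) have "nat (k + int N) < n" by simp
    with assms(3) have "fps_nth (F - G) (nat (k + int N)) = 0"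
      unfolding fps_X_power_dvd_iff by blast
    then show ?thesis using True by simp
  qed simp
  then show ?thesis unfolding assms(1,2)[symmetric] by simp
qed

lemma Phi_locally_constant:
  assumes "Phi x = Some (f :: 'm :: nontriv mod_ring fls)"
  shows "\<forall>\<^sub>F y in nhds x. \<exists>g. Phi y = Some g \<and> (\<forall>k<n. fls_nth g k = fls_nth f k)"
proof -
  have "x \<noteq> NegInf" using assms by auto
  then obtain N where N: "translate (int N) x \<in> cantor_ge1"
    using translate_into_cantor_ge1 by blast
  define e where "e = nat (n + int N)"
  have "\<forall>\<^sub>F z in nhds (translate (int N) x). z \<in> cantor_ge1"
    using N open_RatPlus_atLeast by (rule eventually_nhds_in_open[rotated])
  with cantor_fps_locally_constant[OF N, of e, where ?'m = 'm]
  have "\<forall>\<^sub>F z in nhds (translate (int N) x). z \<in> cantor_ge1 \<and>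
      fps_X ^ e dvd (cantor_fps z :: 'm mod_ring fps) - cantor_fps (translate (int N) x)"
    by eventually_elim blast
  then have "\<forall>\<^sub>F y in nhds x. translate (int N) y \<in> cantor_ge1 \<and> fps_X ^ e dvd
      (cantor_fps (translate (int N) y) :: 'm mod_ring fps) - cantor_fps (translate (int N) x)"
    using tendsto_translate by (rule eventually_compose_filterlim)
  then show ?thesis
  proof eventually_elim
    case (elim y)
    obtain f' :: "'m mod_ring fls" where f': "Phi x = Some f'"
      "fls_translate N f' = fps_to_fls (cantor_fps (translate (int N) x))"
      by (rule Phi_eq_Some_translate[OF N])
    obtain g :: "'m mod_ring fls" where g: "Phi y = Some g"
      "fls_translate N g = fps_to_fls (cantor_fps (translate (int N) y))"
      using Phi_eq_Some_translate[of N y] elim by blast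
    have "fls_nth g k = fls_nth f' k" if "k < n" for k
      using elim that by (intro fls_translate_eq_fps_agree[OF g(2) f'(2), of e]) (auto simp: e_def)
    then show ?case using g(1) f'(1) assms by auto
  qed
qed

lemma translate_le_iff [simp]: "translate k x \<le> translate k y \<longleftrightarrow> x \<le> y"
  by (metis translate_less_iff not_less)

text \<open>
  Continuity at $-\infty$: far to the left the pole order is large. If $N$ translations by $1$
  carry \<open>y\<close> into $[1_+, 2_-]$, the image $q^N g + [N]_q$ has vanishing coefficient at $q$, so
  $g$ has coefficient $-1$ at $q^{1-N}$.
\<close>

lemma Phi_near_NegInf:
  assumes "y < RatMinus (- of_nat n)" "Phi y = Some (g :: 'm :: nontriv mod_ring fls)"
  shows "\<exists>k < - int n. fls_nth g k \<noteq> 0"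
proof -
  have "y \<noteq> NegInf" using assms(2) by auto
  then have ex: "\<exists>N. translate (int N) y \<in> cantor_ge1"
    using translate_into_cantor_ge1 by blast
  \<comment> \<open>one translation fewer stays below $1_+$, so this translate is at most $2_-$\<close>
  define N where "N = (LEAST N. translate (int N) y \<in> cantor_ge1)"
  have N: "translate (int N) y \<in> cantor_ge1" unfolding N_def by (rule LeastI_ex[OF ex])
  have "translate (- int N) (RatPlus 1) \<le> translate (- int N) (translate (int N) y)"
    using N unfolding translate_le_iff by simp
  then have "RatPlus (1 - of_nat N) \<le> y" by simp
  then have "RatPlus (1 - of_nat N) < RatMinus (- of_nat n)" using assms(1) by (rule le_less_trans)
  then have "(1 - of_nat N :: rat) < - of_nat n" by (simp add: less_le)
  then have "(of_nat (n + 1) :: rat) < of_nat N" by simp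
  then have nN: "n + 1 < N" by (simp only: of_nat_less_iff)
  have "translate (int (N - 1)) y \<notin> cantor_ge1"
    using not_less_Least[of "N - 1" "\<lambda>N. translate (int N) y \<in> cantor_ge1"] nN by (simp add: N_def)
  then have "translate (int (N - 1)) y < RatPlus 1" by (simp add: not_le)
  then have "translate (int (N - 1)) y \<le> RatMinus 1" by (simp only: less_RatPlus_iff)
  then have "translate 1 (translate (int (N - 1)) y) \<le> translate 1 (RatMinus 1)"
    by (simp only: translate_le_iff)
  then have "translate (int N) y \<le> RatMinus 2" using nN by (simp add: of_nat_diff)
  with N have "translate (int N) y \<in> hj_cylinder 2" by simp
  then obtain z where z: "z \<in> cantor_ge1" "translate (int N) y = hj_branch 2 z"
    using hj_branch_surj by metis
  obtain g' :: "'m mod_ring fls" where g': "Phi y = Some g'"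
    "fls_translate N g' = fps_to_fls (cantor_fps (hj_branch 2 z))"
    by (rule Phi_eq_Some_translate[OF N, unfolded z(2)])
  have "fls_nth (fls_translate N g) 1 = fps_nth (cantor_fps (hj_branch 2 z)) 1"
    using g' assms(2) by simp
  also have "\<dots> = 0" using z(1) by (simp add: cantor_fps_branch_nth)
  finally have "fls_nth g (1 - int N) + 1 = 0" using nN by simp
  then have "fls_nth g (1 - int N) \<noteq> 0" by auto
  then show ?thesis using nN by (intro exI[of _ "1 - int N"]) auto
qed

lemma fls_open_contains_agree:
  assumes "open W" "f \<in> W"
  shows "\<exists>n. \<forall>g :: 'a :: group_add fls. (\<forall>k<n. fls_nth g k = fls_nth f k) \<longrightarrow> g \<in> W"
proof -
  obtain e where e: "e > 0" "ball f e \<subseteq> W" using assms by (meson openE)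
  obtain n where n: "inverse (2 ^ n) < e"
    using reals_power_lt_ex[OF e(1), of 2] by (auto simp: power_inverse field_simps)
  have "g \<in> W" if agree: "\<forall>k < int n. fls_nth g k = fls_nth f k" for g
  proof (cases "g = f")
    case False
    have "int n \<le> fls_subdegree (g - f)"
      using False agree by (intro fls_subdegree_geI) auto
    then have "2 powi (- fls_subdegree (g - f)) \<le> (2 powi (- int n) :: real)"
      by (intro power_int_increasing) auto
    also have "\<dots> = inverse (2 ^ n)" by (simp add: power_int_minus)
    also note n
    finally have "dist g f < e" unfolding dist_fls_eq_powi[OF False] .
    then show ?thesis using e(2) by (auto simp: dist_commute)
  qed (use assms in simp)
  then show ?thesis by blast
qed

lemma fls_bounded_pole_order:
  assumes "bounded C"
  obtains n where "\<And>f k. f \<in> C \<Longrightarrow> k < - int n \<Longrightarrow> fls_nth (f :: 'a :: group_add fls) k = 0"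
proof -
  obtain B where B: "\<And>f. f \<in> C \<Longrightarrow> dist 0 f \<le> B"
    using assms bounded_any_center[of C 0] by auto
  obtain n where n: "B < 2 ^ n" using real_arch_pow[of 2 B] by auto
  show ?thesis
  proof (rule that, rule ccontr)
    fix f k assume f: "f \<in> C" "k < - int n" "fls_nth f k \<noteq> 0"
    then have "fls_subdegree f \<le> k" by (intro fls_subdegree_leI)
    then have "2 powi int n \<le> (2 powi (- fls_subdegree f) :: real)"
      using f(2) by (intro power_int_increasing) linarith+
    also have "\<dots> = dist f 0" using f(3) by (subst dist_fls_eq_powi) auto
    also have "\<dots> \<le> B" using B[OF f(1)] by (simp add: dist_commute)
    finally show False using n by simp
  qed
qed

lemma continuous_map_Phi:
  "continuous_map euclidean (Alexandroff_compactification euclidean)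
    (Phi :: cantor_line \<Rightarrow> 'm :: nontriv mod_ring fls option)"
proof -
  let ?Phi = "Phi :: cantor_line \<Rightarrow> 'm mod_ring fls option"
  have "open {x. ?Phi x \<in> U}" if U: "openin (Alexandroff_compactification euclidean) U" for U
  proof -
    have fin: "open {f. Some f \<in> U}"
      using openin_continuous_map_preimage[OF continuous_map_Some U] by simp
    have ev: "\<forall>\<^sub>F y in nhds x. ?Phi y \<in> U" if x: "?Phi x \<in> U" for x
    proof (cases "?Phi x")
      case (Some f)
      with x fin obtain n where n: "\<And>g. (\<forall>k<n. fls_nth g k = fls_nth f k) \<Longrightarrow> Some g \<in> U"
        using fls_open_contains_agree[of "{f. Some f \<in> U}" f] by auto
      show ?thesis
        using Phi_locally_constant[OF Some, of n] by eventually_elim (use n in auto)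
    next
      case None
      then have NegInf: "x = NegInf" by (simp only: Phi_eq_None_iff)
      from None x U obtain C where C: "compact C" "U = insert None (Some ` (- C))"
        unfolding openin_Alexandroff_compactification by (auto simp: Compl_eq_Diff_UNIV)
      obtain n where n: "\<And>f k. f \<in> C \<Longrightarrow> k < - int n \<Longrightarrow> fls_nth f k = 0"
        using fls_bounded_pole_order[OF compact_imp_bounded[OF C(1)]] by blast
      have "NegInf < RatMinus (- of_nat n)" by (simp add: less_cantor_line_def)
      then have "\<forall>\<^sub>F y in nhds x. y \<in> {..<RatMinus (- of_nat n)}"
        unfolding NegInf by (intro eventually_nhds_in_open) auto
      then show ?thesis
      proof eventually_elim
        case (elim y)
        show ?case
        proof (cases "?Phi y")
          case (Some g)
          then have "g \<notin> C" using Phi_near_NegInf[of y n g] elim n by auto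
          then show ?thesis using Some C(2) by auto
        qed (simp add: C(2))
      qed
    qed
    show ?thesis
    proof (subst open_subopen, intro ballI)
      fix x assume "x \<in> {x. ?Phi x \<in> U}"
      then obtain S where "open S" "x \<in> S" "\<forall>y\<in>S. ?Phi y \<in> U"
        using ev[of x] unfolding eventually_nhds by auto
      then show "\<exists>T. open T \<and> x \<in> T \<and> T \<subseteq> {x. ?Phi x \<in> U}" by blast
    qed
  qed
  moreover have "topspace (Alexandroff_compactification euclidean) = (UNIV :: 'm mod_ring fls option set)"
    by (auto simp: UNIV_option_conv)
  ultimately show ?thesis by (auto simp: continuous_map_def)
qed

section \<open>The closed embedding\<close>

lemma Hausdorff_Alexandroff_fls:
  "Hausdorff_space (Alexandroff_compactification (euclidean :: 'a :: {comm_ring_1, finite} fls topology))"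
proof -
  have "locally_compact_space (euclidean :: 'a fls topology)"
    unfolding locally_compact_space_def
  proof (intro ballI)
    fix f :: "'a fls"
    show "\<exists>U K. openin euclidean U \<and> compactin euclidean K \<and> f \<in> U \<and> U \<subseteq> K"
      by (intro exI[of _ "ball 0 (dist 0 f + 1)"] exI[of _ "cball 0 (dist 0 f + 1)"])
        (auto simp: compact_cball_fls)
  qed
  then show ?thesis
    by (simp add: Hausdorff_space_Alexandroff_compactification)
qed

text \<open>A continuous map from a compact space to a Hausdorff space is closed.\<close>

lemma closed_map_Phi:
  "closed_map euclidean (Alexandroff_compactification euclidean)
    (Phi :: cantor_line \<Rightarrow> 'm :: nontriv mod_ring fls option)"
proof (rule continuous_imp_closed_map)
  show "compact_space (euclidean :: cantor_line topology)"
    using compact_UNIV_cantor_line by (simp add: compact_space_def)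
qed (simp_all add: Hausdorff_Alexandroff_fls continuous_map_Phi)

section \<open>Surjectivity for $m = 2$\<close>

text \<open>
  Over $\mathbb F_2$ a coefficient that is not $1$ vanishes, so every series with constant
  coefficient $1$, other than the image of $+\infty$, has the shape $[c]_q - q^{c-1} h$ with
  $h(0) = 1$. Approximating $1/h$ by an image and applying the branch of $c$ approximates the series.
\<close>

lemma cantor_fps_dense:
  fixes f :: "'m :: nontriv mod_ring fps"
  assumes "CARD('m) = 2" "fps_nth f 0 = 1"
  shows "\<exists>x\<in>cantor_ge1. fps_X ^ n dvd cantor_fps x - f"
  using assms(2)
proof (induction n arbitrary: f)
  case 0
  show ?case by (intro bexI[of _ PosInf]) auto
next
  case (Suc n f)
  have "{0, 1 :: 'm mod_ring} = UNIV"
    by (rule card_subset_eq) (auto simp: assms(1))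
  then have F2: "a = 0 \<or> a = 1" for a :: "'m mod_ring" by blast
  show ?case
  proof (cases "\<forall>k. fps_nth f k = 1")
    case True
    then show ?thesis
      by (intro bexI[of _ PosInf]) (auto simp: fps_X_power_dvd_iff cantor_fps_PosInf_nth simp del: power_Suc)
  next
    case False
    define k where "k = (LEAST k. fps_nth f k \<noteq> 1)"
    have k: "fps_nth f k \<noteq> 1" using False unfolding k_def by (metis (mono_tags, lifting) LeastI)
    then have fk: "fps_nth f k = 0" using F2 by blast
    have less: "fps_nth f i = 1" if "i < k" for i
      using not_less_Least[of i "\<lambda>k. fps_nth f k \<noteq> 1"] that by (simp add: k_def)
    have c: "2 \<le> Suc k" using k Suc.prems by (cases k) auto
    define h where "h = fps_shift k (fps_red (q_int (Suc k)) - f)"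
    have h0: "fps_nth h 0 = 1" using fk by (simp add: h_def q_int_nth)
    have f: "f = fps_red (q_int (Suc k)) - fps_X ^ k * h"
      by (rule fps_ext) (auto simp: h_def fps_X_power_mult_nth q_int_nth less)
    have inv: "fps_unit_inv (fps_unit_inv h) = h"
      using fps_unit_inv[OF h0] by (intro fps_unit_inv_unique) (simp_all add: mult.commute)
    obtain x where x: "x \<in> cantor_ge1" "fps_X ^ n dvd cantor_fps x - fps_unit_inv h"
      using Suc.IH[of "fps_unit_inv h"] by auto
    have "hj_branch (Suc k) x \<in> hj_cylinder (Suc k)" by (rule hj_branch_in_cylinder[OF x(1)])
    moreover have "RatPlus 1 \<le> RatPlus (of_nat (Suc k) - 1)" using c by simp
    ultimately have "hj_branch (Suc k) x \<in> cantor_ge1"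
      by (meson atLeastAtMost_iff atLeast_iff order.trans)
    moreover have "fps_X ^ Suc n dvd cantor_fps (hj_branch (Suc k) x) - f"
      using cantor_fps_branch_cong[OF x(1) c _ x(2)] unfolding inv by (simp add: f)
    ultimately show ?thesis by blast
  qed
qed

lemma range_Phi_dense:
  fixes f :: "'m :: nontriv mod_ring fls"
  assumes "CARD('m) = 2"
  shows "\<exists>x g. Phi x = Some g \<and> (\<forall>k<n. fls_nth g k = fls_nth f k)"
proof -
  \<comment> \<open>so that $q^N f$ has no constant coefficient and $[N]_q$ contributes $1$\<close>
  define N where "N = nat (1 - fls_subdegree f) + 1"
  define F where "F = fls_regpart (fls_translate N f)"
  have "fls_nth f (k - int N) = 0" if "k \<le> 0" for k
    using that by (intro fls_eq0_below_subdegree) (simp add: N_def)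
  then have F: "fls_translate N f = fps_to_fls F" and F0: "fps_nth F 0 = 1"
    by (auto simp: F_def N_def intro!: fls_eqI)
  obtain x where x: "x \<in> cantor_ge1" "fps_X ^ nat (n + int N) dvd cantor_fps x - F"
    using cantor_fps_dense[OF assms F0] by blast
  define y where "y = translate (- int N) x"
  have xy: "translate (int N) y = x" by (simp add: y_def)
  obtain g :: "'m mod_ring fls" where g: "Phi y = Some g" "fls_translate N g = fps_to_fls (cantor_fps x)"
    using Phi_eq_Some_translate[of N y] x(1) unfolding xy by blast
  have "fls_nth g k = fls_nth f k" if "k < n" for k
    using that by (intro fls_translate_eq_fps_agree[OF g(2) F x(2)]) auto
  with g(1) show ?thesis by blast
qed

text \<open>The range is closed, so density suffices.\<close>

lemma surj_Phi:
  assumes "CARD('m :: nontriv) = 2"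
  shows "range (Phi :: cantor_line \<Rightarrow> 'm mod_ring fls option) = UNIV"
proof -
  let ?Phi = "Phi :: cantor_line \<Rightarrow> 'm mod_ring fls option"
  have "closedin (Alexandroff_compactification euclidean) (range ?Phi)"
    using closed_map_Phi by (auto simp: closed_map_def)
  then have closed: "closed {f. Some f \<in> range ?Phi}"
    using closedin_continuous_map_preimage[OF continuous_map_Some, of euclidean "range ?Phi"] by simp
  have "Some f \<in> range ?Phi" for f
  proof (rule ccontr)
    assume "Some f \<notin> range ?Phi"
    moreover have "open (- {f. Some f \<in> range ?Phi})" using closed by (rule open_Compl)
    ultimately obtain n where n: "\<And>g. (\<forall>k<n. fls_nth g k = fls_nth f k) \<Longrightarrow> Some g \<notin> range ?Phi"
      using fls_open_contains_agree[of "- {f. Some f \<in> range ?Phi}" f] by auto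
    show False using range_Phi_dense[OF assms, of n f] n by (metis rangeI)
  qed
  moreover have "None \<in> range ?Phi" by (rule range_eqI[of _ _ NegInf]) simp
  ultimately show ?thesis by (metis UNIV_eq_I option.exhaust)
qed

theorem theorem8p1:
  shows "inj (Phi :: cantor_line \<Rightarrow> 'm :: nontriv mod_ring fls option)
    \<and> (embedding_map euclidean projective_line
          (Phi :: cantor_line \<Rightarrow> 'p :: prime_card mod_ring fls option)
       \<and> closedin projective_line
          (range (Phi :: cantor_line \<Rightarrow> 'p mod_ring fls option)))
    \<and> (CARD('p) = 2 \<longrightarrow>
        homeomorphic_map euclidean projective_line
          (Phi :: cantor_line \<Rightarrow> 'p mod_ring fls option))"
proof (intro conjI impI)
  let ?Phi = "Phi :: cantor_line \<Rightarrow> 'p mod_ring fls option"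
  show "inj (Phi :: cantor_line \<Rightarrow> 'm mod_ring fls option)" by (rule inj_Phi)
  show emb: "embedding_map euclidean projective_line ?Phi"
    unfolding projective_line_eq_Alexandroff_compactification
    using inj_Phi continuous_map_Phi closed_map_Phi by (intro injective_closed_imp_embedding_map) simp_all
  show "closedin projective_line (range ?Phi)"
    unfolding projective_line_eq_Alexandroff_compactification
    using closed_map_Phi by (auto simp: closed_map_def)
  assume "CARD('p) = 2"
  then have "range ?Phi = UNIV" by (rule surj_Phi)
  moreover have "topspace projective_line = (UNIV :: 'p mod_ring fls option set)"
    unfolding projective_line_eq_Alexandroff_compactification by (auto simp: UNIV_option_conv)
  ultimately show "homeomorphic_map euclidean projective_line ?Phi"
    using emb by (simp flip: surjective_embedding_map)
qed

end
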